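(* Let $n\ge 1$ and let $t\ge 0$ be an even integer. Let $G$ be the graph obtained from the complete graph $K_n$ by subdividing every edge exactly $t$ times (i.e., replacing each edge by a path with $t$ new internal vertices). Then $G$ admits a drawing $\varphi$ in $\mathbb{R}^2$ such that for every pair of shortest paths $P_1,P_2$ in $G$, the curves $\varphi(P_1)$ and $\varphi(P_2)$ cross at most four times.
   Context: A drawing $\varphi$ of a graph $G$ in $\mathbb{R}^2$ maps the vertices to pairwise distinct points and each edge to a Jordan arc between the images of its two end-vertices that is disjoint from the image of every other vertex. For a path $P=v_1,\dots,v_n$ in $G$, $\varphi(P)$ denotes the arc obtained by concatenating the curves $\varphi(v_1v_2),\dots,\varphi(v_{n-1}v_n)$. For two curves $\gamma_1,\gamma_2:[0,1]\to\mathbb{R}^2$, a meet is a pair of maximal intervals $I_1,I_2\subseteq[0,1]$ together with a bijection $\iota:I_1\to I_2$ such that $\gamma_1(x)=\gamma_2(\iota(x))$ for all $x\in I_1$. A crossing is a meet with $(I_1\cup I_2)\cap\{0,1\}=\emptyset$. Two curves cross $k$ times if they have $k$ pairwise distinct crossings. *)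

theory Defs
  imports
    "HOL-Analysis.Analysis"
    "Graph_Theory.Graph_Theory"
begin

text \<open>Undirected graphs are symmetric loop-free digraphs, as in Graph_Theory.\<close>

text \<open>
  \<open>Inner u v k\<close> with \<open>u < v\<close> is the \<open>k\<close>-th new vertex on the edge \<open>uv\<close>, counted from \<open>u\<close>.
  The linear order only serves to name each new vertex once.
\<close>

datatype 'a sd_vertex = Branch 'a | Inner 'a 'a nat

definition sd_point :: "nat \<Rightarrow> 'a \<Rightarrow> 'a \<Rightarrow> nat \<Rightarrow> 'a sd_vertex" where
  "sd_point t u v k =
     (if k = 0 then Branch u else if k = t + 1 then Branch v else Inner u v k)"

definition subdivide_all ::
    "nat \<Rightarrow> 'a::linorder pair_pre_digraph \<Rightarrow> 'a sd_vertex pair_pre_digraph" where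
  "subdivide_all t G =
     \<lparr> pverts = Branch ` pverts G \<union>
         {Inner u v k | u v k. (u, v) \<in> parcs G \<and> u < v \<and> 1 \<le> k \<and> k \<le> t},
       parcs = (let A = {(sd_point t u v k, sd_point t u v (k + 1)) | u v k.
                           (u, v) \<in> parcs G \<and> u < v \<and> k \<le> t}
                in A \<union> A\<inverse>) \<rparr>"

lemma subdivide_all_0:
  assumes "pair_graph G"
  shows "pverts (subdivide_all 0 G) = Branch ` pverts G"
    and "parcs (subdivide_all 0 G) = map_prod Branch Branch ` parcs G"
proof -
  interpret pair_graph G by fact
  show "pverts (subdivide_all 0 G) = Branch ` pverts G"
    by (auto simp: subdivide_all_def)
  have s: "(v, u) \<in> parcs G" if "(u, v) \<in> parcs G" for u v
    using that by (rule arcs_symmetric)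
  have n: "u \<noteq> v" if "(u, v) \<in> parcs G" for u v
    using pair_no_loops[OF that] by simp
  show "parcs (subdivide_all 0 G) = map_prod Branch Branch ` parcs G" (is "?L = ?R")
  proof
    show "?L \<subseteq> ?R"
      by (force simp: subdivide_all_def Let_def sd_point_def intro: s)
    show "?R \<subseteq> ?L"
    proof
      fix e assume "e \<in> ?R"
      then obtain u v where e: "e = (Branch u, Branch v)" and uv: "(u, v) \<in> parcs G" by auto
      show "e \<in> ?L"
        using n[OF uv] s[OF uv] uv unfolding e subdivide_all_def Let_def sd_point_def
        by (cases u v rule: linorder_cases) auto
    qed
  qed
qed

lemma pair_graph_subdivide_all:
  assumes "pair_graph G"
  shows "pair_graph (subdivide_all t G)"
proof -
  interpret pair_graph G by fact
  define A where "A = {(sd_point t u v k, sd_point t u v (k + 1)) | u v k.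
                         (u, v) \<in> parcs G \<and> u < v \<and> k \<le> t}"
  have arcs: "parcs (subdivide_all t G) = A \<union> A\<inverse>"
    by (simp add: subdivide_all_def A_def Let_def)
  have "A \<subseteq> (\<lambda>((u, v), k). (sd_point t u v k, sd_point t u v (k + 1))) ` (parcs G \<times> {..t})"
    by (force simp: A_def)
  then have finA: "finite A" by (rule finite_subset) auto
  have "{Inner u v k | u v k. (u, v) \<in> parcs G \<and> u < v \<and> 1 \<le> k \<and> k \<le> t}
          \<subseteq> (\<lambda>((u, v), k). Inner u v k) ` (parcs G \<times> {..t})"
    by force
  then have "finite {Inner u v k | u v k. (u, v) \<in> parcs G \<and> u < v \<and> 1 \<le> k \<and> k \<le> t}"
    by (rule finite_subset) auto
  then have finV: "finite (pverts (subdivide_all t G))"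
    by (simp add: subdivide_all_def)
  have pt: "sd_point t u v k \<in> pverts (subdivide_all t G)"
    if "(u, v) \<in> parcs G" "u < v" "k \<le> t + 1" for u v k
    using that in_arcsD1[OF that(1)] in_arcsD2[OF that(1)]
    by (auto simp: subdivide_all_def sd_point_def)
  have wf: "x \<in> pverts (subdivide_all t G) \<and> y \<in> pverts (subdivide_all t G) \<and> x \<noteq> y"
    if "(x, y) \<in> A" for x y
    using that by (auto simp: A_def intro!: pt) (auto simp: sd_point_def split: if_splits)
  show ?thesis
  proof
    fix e assume "e \<in> parcs (subdivide_all t G)"
    then show "fst e \<in> pverts (subdivide_all t G)" "snd e \<in> pverts (subdivide_all t G)"
      "fst e \<noteq> snd e"
      by (cases e; auto simp: arcs dest: wf)+
  next
    show "finite (pverts (subdivide_all t G))" by (rule finV)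
    show "finite (parcs (subdivide_all t G))" using finA by (simp add: arcs)
    show "symmetric (with_proj (subdivide_all t G))"
      by (auto simp: symmetric_def arcs sym_def)
  qed
qed

definition shortest_path :: "'a pair_pre_digraph \<Rightarrow> 'a vwalk \<Rightarrow> bool" where
  "shortest_path G p \<longleftrightarrow> vpath p G \<and>
     (\<forall>q. vpath q G \<and> hd q = hd p \<and> last q = last p \<longrightarrow> vwalk_length p \<le> vwalk_length q)"

text \<open>
  A drawing consists of a point for every vertex and a Jordan arc for every edge
  \<open>{u, v}\<close>, parametrised in either of its two directions.
\<close>

definition is_drawing ::
    "'a pair_pre_digraph \<Rightarrow> ('a \<Rightarrow> real \<times> real) \<Rightarrow> ('a set \<Rightarrow> real \<Rightarrow> real \<times> real) \<Rightarrow> bool" where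
  "is_drawing G pos crv \<longleftrightarrow>
     inj_on pos (pverts G) \<and>
     (\<forall>(u, v) \<in> parcs G.
        arc (crv {u, v}) \<and>
        {pathstart (crv {u, v}), pathfinish (crv {u, v})} = {pos u, pos v} \<and>
        (\<forall>w \<in> pverts G - {u, v}. pos w \<notin> path_image (crv {u, v})))"

definition edge_curve ::
    "('a \<Rightarrow> real \<times> real) \<Rightarrow> ('a set \<Rightarrow> real \<Rightarrow> real \<times> real) \<Rightarrow> 'a \<Rightarrow> 'a \<Rightarrow> real \<Rightarrow> real \<times> real" where
  "edge_curve pos crv u v =
     (if pathstart (crv {u, v}) = pos u then crv {u, v} else reversepath (crv {u, v}))"

text \<open>
  Only paths with at least one edge have a curve. The speed at which the joined curve is
  traversed is irrelevant, since meets are invariant under reparametrisation.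
\<close>

fun path_curve ::
    "('a \<Rightarrow> real \<times> real) \<Rightarrow> ('a set \<Rightarrow> real \<Rightarrow> real \<times> real) \<Rightarrow> 'a vwalk \<Rightarrow> real \<Rightarrow> real \<times> real" where
  "path_curve pos crv [u, v] = edge_curve pos crv u v"
| "path_curve pos crv (u # v # w # p) = edge_curve pos crv u v +++ path_curve pos crv (v # w # p)"

definition common_part ::
    "(real \<Rightarrow> 'b) \<Rightarrow> (real \<Rightarrow> 'b) \<Rightarrow> real set \<Rightarrow> real set \<Rightarrow> (real \<Rightarrow> real) \<Rightarrow> bool" where
  "common_part \<gamma>\<^sub>1 \<gamma>\<^sub>2 I\<^sub>1 I\<^sub>2 \<iota> \<longleftrightarrow>
     is_interval I\<^sub>1 \<and> I\<^sub>1 \<noteq> {} \<and> I\<^sub>1 \<subseteq> {0..1} \<and>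
     is_interval I\<^sub>2 \<and> I\<^sub>2 \<noteq> {} \<and> I\<^sub>2 \<subseteq> {0..1} \<and>
     bij_betw \<iota> I\<^sub>1 I\<^sub>2 \<and> (\<forall>x\<in>I\<^sub>1. \<gamma>\<^sub>1 x = \<gamma>\<^sub>2 (\<iota> x))"

text \<open>
  The bijection is kept \<open>undefined\<close> outside \<open>I\<^sub>1\<close>, so that equal meets are equal triples.
\<close>

definition meets ::
    "(real \<Rightarrow> 'b) \<Rightarrow> (real \<Rightarrow> 'b) \<Rightarrow> (real set \<times> real set \<times> (real \<Rightarrow> real)) set" where
  "meets \<gamma>\<^sub>1 \<gamma>\<^sub>2 = {(I\<^sub>1, I\<^sub>2, \<iota>).
     common_part \<gamma>\<^sub>1 \<gamma>\<^sub>2 I\<^sub>1 I\<^sub>2 \<iota> \<and> \<iota> \<in> extensional I\<^sub>1 \<and>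
     (\<forall>J\<^sub>1 J\<^sub>2 \<kappa>. common_part \<gamma>\<^sub>1 \<gamma>\<^sub>2 J\<^sub>1 J\<^sub>2 \<kappa> \<and> I\<^sub>1 \<subseteq> J\<^sub>1 \<and> I\<^sub>2 \<subseteq> J\<^sub>2 \<and> (\<forall>x\<in>I\<^sub>1. \<kappa> x = \<iota> x)
        \<longrightarrow> J\<^sub>1 = I\<^sub>1 \<and> J\<^sub>2 = I\<^sub>2)}"

definition crossings ::
    "(real \<Rightarrow> 'b) \<Rightarrow> (real \<Rightarrow> 'b) \<Rightarrow> (real set \<times> real set \<times> (real \<Rightarrow> real)) set" where
  "crossings \<gamma>\<^sub>1 \<gamma>\<^sub>2 = {(I\<^sub>1, I\<^sub>2, \<iota>) \<in> meets \<gamma>\<^sub>1 \<gamma>\<^sub>2. (I\<^sub>1 \<union> I\<^sub>2) \<inter> {0, 1} = {}}"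

definition cross_at_most :: "nat \<Rightarrow> (real \<Rightarrow> 'b) \<Rightarrow> (real \<Rightarrow> 'b) \<Rightarrow> bool" where
  "cross_at_most k \<gamma>\<^sub>1 \<gamma>\<^sub>2 \<longleftrightarrow> finite (crossings \<gamma>\<^sub>1 \<gamma>\<^sub>2) \<and> card (crossings \<gamma>\<^sub>1 \<gamma>\<^sub>2) \<le> k"

end

theory Submission
  imports Defs
begin

text \<open>
  Put the branch vertices in general position, say on a parabola, draw every edge of the complete graph
  as a straight chord, and surround the branch vertices by disjoint discs so small that each meets no
  chord except those at its centre. As \<open>t\<close> is even, every subdivision vertex has a nearer end and can
  be placed in the disc of that end.

  A shortest path runs along one chord, along two chords with a common end, or along a whole chord
  and two short pieces inside the discs at its ends, its legs; a longer piece than a leg could be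
  replaced by a detour around the other side of a triangle. The crossings of two arcs are bounded in
  number by any cover of their common points by connected sets. Two pairs of segments give four convex
  intersections. As a leg meets no chord except those at its own corner, two chords with legs meet in
  a single connected set, and each leg meets a pair of adjacent chords in a connected set.
\<close>

hide_const (open) Digraph_Component.connected

section \<open>Unions of at most \<open>k\<close> sets\<close>

definition at_most :: "nat \<Rightarrow> 'b set \<Rightarrow> bool" where
  "at_most k A \<longleftrightarrow> finite A \<and> card A \<le> k"

lemma at_most_union_ofI:
  assumes "finite \<F>" "card \<F> \<le> k" "\<F> \<subseteq> Collect P" "A = \<Union>\<F>"
  shows "(at_most k union_of P) A"
  unfolding union_of_def at_most_def using assms by blast

lemma at_most_union_ofE:
  assumes "(at_most k union_of P) A"
  obtains \<F> where "finite \<F>" "card \<F> \<le> k" "\<F> \<subseteq> Collect P" "A = \<Union>\<F>"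
  using assms unfolding union_of_def at_most_def by blast

lemma at_most_union_of_mono:
  assumes "(at_most k union_of P) A" "k \<le> l"
  shows "(at_most l union_of P) A"
  using assms(1) by (rule at_most_union_ofE) (use \<open>k \<le> l\<close> in \<open>auto intro: at_most_union_ofI\<close>)

lemma at_most_Suc_0_union_of: "P A \<Longrightarrow> (at_most (Suc 0) union_of P) A"
  by (rule union_of_inc) (simp_all add: at_most_def)

lemma at_most_union_of_Un:
  assumes "(at_most k union_of P) A" "(at_most l union_of P) B"
  shows "(at_most (k + l) union_of P) (A \<union> B)"
proof -
  obtain \<F> where \<F>: "finite \<F>" "card \<F> \<le> k" "\<F> \<subseteq> Collect P" "A = \<Union>\<F>"
    using assms(1) by (rule at_most_union_ofE)
  obtain \<G> where \<G>: "finite \<G>" "card \<G> \<le> l" "\<G> \<subseteq> Collect P" "B = \<Union>\<G>"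
    using assms(2) by (rule at_most_union_ofE)
  show ?thesis
  proof (rule at_most_union_ofI)
    show "card (\<F> \<union> \<G>) \<le> k + l"
      using card_Un_le[of \<F> \<G>] \<F>(2) \<G>(2) by linarith
  qed (use \<F> \<G> in auto)
qed

lemma at_most_union_of_Int:
  assumes "(at_most k union_of P) A" "(at_most l union_of P) B"
    and P_Int: "\<And>C D. P C \<Longrightarrow> P D \<Longrightarrow> P (C \<inter> D)"
  shows "(at_most (k * l) union_of P) (A \<inter> B)"
proof -
  obtain \<F> where \<F>: "finite \<F>" "card \<F> \<le> k" "\<F> \<subseteq> Collect P" "A = \<Union>\<F>"
    using assms(1) by (rule at_most_union_ofE)
  obtain \<G> where \<G>: "finite \<G>" "card \<G> \<le> l" "\<G> \<subseteq> Collect P" "B = \<Union>\<G>"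
    using assms(2) by (rule at_most_union_ofE)
  let ?intersections = "(\<lambda>(C, D). C \<inter> D) ` (\<F> \<times> \<G>)"
  show ?thesis
  proof (rule at_most_union_ofI)
    have "card ?intersections \<le> card \<F> * card \<G>"
      using \<F>(1) \<G>(1) card_image_le[of "\<F> \<times> \<G>"] by (simp add: card_cartesian_product)
    also have "\<dots> \<le> k * l"
      using \<F>(2) \<G>(2) by (rule mult_le_mono)
    finally show "card ?intersections \<le> k * l" .
    show "?intersections \<subseteq> Collect P"
      using \<F>(3) \<G>(3) P_Int by auto
    show "A \<inter> B = \<Union>?intersections"
      unfolding \<F>(4) \<G>(4) by auto
  qed (use \<F>(1) \<G>(1) in simp)
qed

lemma union_of_convex_Int:
  fixes A B :: "'b::real_normed_vector set"
  assumes "(at_most k union_of convex) A" "(at_most l union_of convex) B" "k * l \<le> m"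
  shows "(at_most m union_of connected) (A \<inter> B)"
proof -
  have "(at_most (k * l) union_of convex) (A \<inter> B)"
    using assms(1,2) convex_Int by (rule at_most_union_of_Int)
  then have "(at_most (k * l) union_of connected) (A \<inter> B)"
    by (rule union_of_mono) (rule convex_connected)
  then show ?thesis
    using assms(3) by (rule at_most_union_of_mono)
qed

section \<open>Meets of arcs\<close>

lemma arc_eq_iff:
  assumes "arc g" "x \<in> {0..1}" "y \<in> {0..1}"
  shows "g x = g y \<longleftrightarrow> x = y"
  using assms by (auto simp: arc_def inj_on_def)

lemma is_interval_arc_vimage:
  fixes g :: "real \<Rightarrow> 'b::t2_space"
  assumes "arc g" "connected C" "C \<subseteq> path_image g"
  shows "is_interval ({0..1} \<inter> g -` C)"
proof -
  obtain h where inverse: "homeomorphism {0..1} (path_image g) g h"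
    using homeomorphism_arc[OF \<open>arc g\<close>] .
  have "{0..1} \<inter> g -` C = h ` C"
  proof (intro set_eqI iffI)
    fix x assume "x \<in> {0..1} \<inter> g -` C"
    then show "x \<in> h ` C"
      using homeomorphism_apply1[OF inverse, of x] by force
  next
    fix x assume "x \<in> h ` C"
    then obtain z where z: "z \<in> C" "z \<in> path_image g" "x = h z"
      using assms(3) by blast
    moreover have "h z \<in> {0..1}"
      using z(2) homeomorphism_image2[OF inverse] by blast
    ultimately show "x \<in> {0..1} \<inter> g -` C"
      using homeomorphism_apply2[OF inverse] by simp
  qed
  moreover have "connected (h ` C)"
    using homeomorphism_cont2[OF inverse] assms(2,3)
    by (intro connected_continuous_image) (auto intro: continuous_on_subset)
  ultimately show ?thesis
    by (simp add: is_interval_connected_1)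
qed

lemma bij_betw_arc_vimage:
  assumes "arc g" "C \<subseteq> path_image g"
  shows "bij_betw g ({0..1} \<inter> g -` C) C"
  using assms unfolding bij_betw_def arc_def path_image_def inj_on_def by blast

lemma common_part_of_connected:
  fixes g\<^sub>1 g\<^sub>2 :: "real \<Rightarrow> 'b::t2_space"
  assumes "arc g\<^sub>1" "arc g\<^sub>2" "connected C" "C \<noteq> {}" "C \<subseteq> path_image g\<^sub>1 \<inter> path_image g\<^sub>2"
  obtains f where "common_part g\<^sub>1 g\<^sub>2 ({0..1} \<inter> g\<^sub>1 -` C) ({0..1} \<inter> g\<^sub>2 -` C) f"
proof -
  let ?I\<^sub>1 = "{0..1} \<inter> g\<^sub>1 -` C" and ?I\<^sub>2 = "{0..1} \<inter> g\<^sub>2 -` C"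
  have bij: "bij_betw g\<^sub>1 ?I\<^sub>1 C" "bij_betw g\<^sub>2 ?I\<^sub>2 C"
    using assms by (simp_all add: bij_betw_arc_vimage)
  define f where "f = inv_into ?I\<^sub>2 g\<^sub>2 \<circ> g\<^sub>1"
  have "bij_betw f ?I\<^sub>1 ?I\<^sub>2"
    unfolding f_def using bij(1) bij_betw_inv_into[OF bij(2)] by (rule bij_betw_trans)
  moreover have "\<forall>x\<in>?I\<^sub>1. g\<^sub>1 x = g\<^sub>2 (f x)"
    using bij(2) by (simp add: f_def bij_betw_inv_into_right)
  moreover have "is_interval ?I\<^sub>1" "is_interval ?I\<^sub>2"
    using assms by (simp_all add: is_interval_arc_vimage)
  moreover have "?I\<^sub>1 \<noteq> {}" "?I\<^sub>2 \<noteq> {}"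
    using bij \<open>C \<noteq> {}\<close> by (metis bij_betw_empty1)+
  ultimately show thesis
    by (intro that[of f]) (simp add: common_part_def)
qed

lemma common_part_subset_vimage:
  assumes "common_part g\<^sub>1 g\<^sub>2 I\<^sub>1 I\<^sub>2 f"
  shows "I\<^sub>1 \<subseteq> {0..1} \<inter> g\<^sub>1 -` (g\<^sub>1 ` I\<^sub>1)" "I\<^sub>2 \<subseteq> {0..1} \<inter> g\<^sub>2 -` (g\<^sub>1 ` I\<^sub>1)"
  using assms unfolding common_part_def bij_betw_def by auto

lemma common_part_image_subset:
  assumes "common_part g\<^sub>1 g\<^sub>2 I\<^sub>1 I\<^sub>2 f"
  shows "g\<^sub>1 ` I\<^sub>1 \<subseteq> path_image g\<^sub>1 \<inter> path_image g\<^sub>2"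
proof -
  have "I\<^sub>1 \<subseteq> {0..1}" "f ` I\<^sub>1 \<subseteq> {0..1}" "\<forall>x\<in>I\<^sub>1. g\<^sub>1 x = g\<^sub>2 (f x)"
    using assms by (auto simp: common_part_def bij_betw_def)
  then show ?thesis
    unfolding path_image_def by blast
qed

lemma connected_common_part_image:
  assumes "path g\<^sub>1" "common_part g\<^sub>1 g\<^sub>2 I\<^sub>1 I\<^sub>2 f"
  shows "connected (g\<^sub>1 ` I\<^sub>1)"
proof (rule connected_continuous_image)
  show "continuous_on I\<^sub>1 g\<^sub>1"
    using assms continuous_on_subset unfolding path_def common_part_def by blast
  show "connected I\<^sub>1"
    using assms(2) by (simp add: common_part_def is_interval_connected)
qed

lemma common_part_agree:
  assumes "arc g\<^sub>2" "common_part g\<^sub>1 g\<^sub>2 I\<^sub>1 I\<^sub>2 f" "common_part g\<^sub>1 g\<^sub>2 J\<^sub>1 J\<^sub>2 h" "x \<in> I\<^sub>1" "x \<in> J\<^sub>1"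
  shows "f x = h x"
proof -
  have "f x \<in> {0..1}" "h x \<in> {0..1}"
    using assms(2-5) unfolding common_part_def bij_betw_def by blast+
  moreover have "g\<^sub>2 (f x) = g\<^sub>2 (h x)"
    using assms(2-5) unfolding common_part_def by metis
  ultimately show ?thesis
    using arc_eq_iff[OF \<open>arc g\<^sub>2\<close>] by blast
qed

lemma meet_contains_connected:
  fixes g\<^sub>1 g\<^sub>2 :: "real \<Rightarrow> 'b::t2_space"
  assumes arcs: "arc g\<^sub>1" "arc g\<^sub>2" and meet: "(I\<^sub>1, I\<^sub>2, f) \<in> meets g\<^sub>1 g\<^sub>2"
    and C: "connected C" "C \<subseteq> path_image g\<^sub>1 \<inter> path_image g\<^sub>2" and x: "x \<in> I\<^sub>1" "g\<^sub>1 x \<in> C"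
  shows "{0..1} \<inter> g\<^sub>1 -` C \<subseteq> I\<^sub>1"
proof -
  have common: "common_part g\<^sub>1 g\<^sub>2 I\<^sub>1 I\<^sub>2 f"
    using meet by (simp add: meets_def)
  have maximal: "J\<^sub>1 = I\<^sub>1"
    if "common_part g\<^sub>1 g\<^sub>2 J\<^sub>1 J\<^sub>2 h" "I\<^sub>1 \<subseteq> J\<^sub>1" "I\<^sub>2 \<subseteq> J\<^sub>2" "\<forall>x\<in>I\<^sub>1. h x = f x" for J\<^sub>1 J\<^sub>2 h
    using meet that unfolding meets_def by blast
  define D where "D = g\<^sub>1 ` I\<^sub>1 \<union> C"
  have "connected D"
    unfolding D_def using connected_common_part_image[OF arc_imp_path[OF \<open>arc g\<^sub>1\<close>] common] C(1) x
    by (intro connected_Un) auto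
  moreover have "D \<noteq> {}" "D \<subseteq> path_image g\<^sub>1 \<inter> path_image g\<^sub>2"
    using common_part_image_subset[OF common] C(2) x by (auto simp: D_def)
  ultimately obtain h where extension: "common_part g\<^sub>1 g\<^sub>2 ({0..1} \<inter> g\<^sub>1 -` D) ({0..1} \<inter> g\<^sub>2 -` D) h"
    using common_part_of_connected[OF arcs] by blast
  have subset: "I\<^sub>1 \<subseteq> {0..1} \<inter> g\<^sub>1 -` D" "I\<^sub>2 \<subseteq> {0..1} \<inter> g\<^sub>2 -` D"
    using common_part_subset_vimage[OF common] by (auto simp: D_def)
  moreover have "\<forall>x\<in>I\<^sub>1. h x = f x"
    using common_part_agree[OF \<open>arc g\<^sub>2\<close> extension common] subset(1) by blast
  ultimately have "{0..1} \<inter> g\<^sub>1 -` D = I\<^sub>1"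
    by (rule maximal[OF extension])
  then show ?thesis by (auto simp: D_def)
qed

lemma meets_eqI:
  fixes g\<^sub>1 g\<^sub>2 :: "real \<Rightarrow> 'b::t2_space"
  assumes arcs: "arc g\<^sub>1" "arc g\<^sub>2"
    and meets: "(I\<^sub>1, I\<^sub>2, f) \<in> meets g\<^sub>1 g\<^sub>2" "(J\<^sub>1, J\<^sub>2, h) \<in> meets g\<^sub>1 g\<^sub>2"
    and x: "x \<in> I\<^sub>1" "x \<in> J\<^sub>1"
  shows "(I\<^sub>1, I\<^sub>2, f) = (J\<^sub>1, J\<^sub>2, h)"
proof -
  have common: "common_part g\<^sub>1 g\<^sub>2 I\<^sub>1 I\<^sub>2 f" "common_part g\<^sub>1 g\<^sub>2 J\<^sub>1 J\<^sub>2 h"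
    and extensional: "f \<in> extensional I\<^sub>1" "h \<in> extensional J\<^sub>1"
    using meets by (auto simp: meets_def)
  note connected_image = connected_common_part_image[OF arc_imp_path[OF \<open>arc g\<^sub>1\<close>]]
  have "J\<^sub>1 \<subseteq> I\<^sub>1"
    using meet_contains_connected[OF arcs meets(1) connected_image common_part_image_subset]
      common_part_subset_vimage(1) common(2) x by blast
  moreover have "I\<^sub>1 \<subseteq> J\<^sub>1"
    using meet_contains_connected[OF arcs meets(2) connected_image common_part_image_subset]
      common_part_subset_vimage(1) common(1) x by blast
  ultimately have "I\<^sub>1 = J\<^sub>1" by blast
  moreover from this have "f = h"
    using extensional common_part_agree[OF \<open>arc g\<^sub>2\<close> common]
    by (intro extensionalityI[of f I\<^sub>1]) auto
  ultimately show ?thesis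
    using common by (auto simp: common_part_def bij_betw_def)
qed

lemma meets_eq_if_connected:
  fixes g\<^sub>1 g\<^sub>2 :: "real \<Rightarrow> 'b::t2_space"
  assumes arcs: "arc g\<^sub>1" "arc g\<^sub>2" and meets: "m \<in> meets g\<^sub>1 g\<^sub>2" "m' \<in> meets g\<^sub>1 g\<^sub>2"
    and C: "connected C" "C \<subseteq> path_image g\<^sub>1 \<inter> path_image g\<^sub>2"
    and x: "x \<in> fst m" "g\<^sub>1 x \<in> C" and y: "y \<in> fst m'" "y \<in> {0..1}" "g\<^sub>1 y \<in> C"
  shows "m = m'"
proof -
  obtain I\<^sub>1 I\<^sub>2 f J\<^sub>1 J\<^sub>2 h where triples: "m = (I\<^sub>1, I\<^sub>2, f)" "m' = (J\<^sub>1, J\<^sub>2, h)"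
    by (cases m, cases m')
  have "y \<in> I\<^sub>1"
    using meet_contains_connected[OF arcs _ C, of I\<^sub>1 I\<^sub>2 f x] meets(1) x y(2,3) by (auto simp: triples)
  then show ?thesis
    unfolding triples using meets y(1) by (intro meets_eqI[OF arcs]) (simp_all add: triples)
qed

lemma meet_intersects_path_images:
  assumes "m \<in> meets g\<^sub>1 g\<^sub>2"
  obtains x where "x \<in> fst m" "x \<in> {0..1}" "g\<^sub>1 x \<in> path_image g\<^sub>1 \<inter> path_image g\<^sub>2"
proof -
  obtain I\<^sub>1 I\<^sub>2 f where m: "m = (I\<^sub>1, I\<^sub>2, f)" and common: "common_part g\<^sub>1 g\<^sub>2 I\<^sub>1 I\<^sub>2 f"
    using assms by (cases m) (auto simp: meets_def)
  obtain x where "x \<in> I\<^sub>1" "x \<in> {0..1}"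
    using common unfolding common_part_def by blast
  then show thesis
    using that[of x] common_part_image_subset[OF common] by (auto simp: m)
qed

lemma cross_at_most_if_union_of_connected:
  fixes g\<^sub>1 g\<^sub>2 :: "real \<Rightarrow> 'b::t2_space"
  assumes arcs: "arc g\<^sub>1" "arc g\<^sub>2"
    and "(at_most k union_of connected) (path_image g\<^sub>1 \<inter> path_image g\<^sub>2)"
  shows "cross_at_most k g\<^sub>1 g\<^sub>2"
proof -
  obtain \<F> where \<F>: "finite \<F>" "card \<F> \<le> k" "\<F> \<subseteq> Collect connected"
    and cover: "path_image g\<^sub>1 \<inter> path_image g\<^sub>2 = \<Union>\<F>"
    using assms(3) by (rule at_most_union_ofE)
  have "\<exists>C\<in>\<F>. \<exists>x\<in>fst m. x \<in> {0..1} \<and> g\<^sub>1 x \<in> C" if "m \<in> meets g\<^sub>1 g\<^sub>2" for m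
    using meet_intersects_path_images[OF that] unfolding cover by blast
  then obtain part where part: "\<And>m. m \<in> meets g\<^sub>1 g\<^sub>2 \<Longrightarrow> part m \<in> \<F>"
    and touches: "\<And>m. m \<in> meets g\<^sub>1 g\<^sub>2 \<Longrightarrow> \<exists>x\<in>fst m. x \<in> {0..1} \<and> g\<^sub>1 x \<in> part m"
    by metis
  have "inj_on part (meets g\<^sub>1 g\<^sub>2)"
  proof (rule inj_onI)
    fix m m' assume meets: "m \<in> meets g\<^sub>1 g\<^sub>2" "m' \<in> meets g\<^sub>1 g\<^sub>2" and same: "part m = part m'"
    have "connected (part m)" "part m \<subseteq> path_image g\<^sub>1 \<inter> path_image g\<^sub>2"
      using \<F>(3) cover part[OF meets(1)] by blast+
    then show "m = m'"
      using meets_eq_if_connected[OF arcs meets] touches[OF meets(1)] touches[OF meets(2)] same by metis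
  qed
  moreover have "part ` meets g\<^sub>1 g\<^sub>2 \<subseteq> \<F>"
    using part by blast
  ultimately have "finite (meets g\<^sub>1 g\<^sub>2)" "card (meets g\<^sub>1 g\<^sub>2) \<le> k"
    using \<F>(1,2) inj_on_finite[of part] card_inj_on_le[of part "meets g\<^sub>1 g\<^sub>2" \<F>] by auto
  moreover have "crossings g\<^sub>1 g\<^sub>2 \<subseteq> meets g\<^sub>1 g\<^sub>2"
    unfolding crossings_def by blast
  ultimately show ?thesis
    unfolding cross_at_most_def by (auto intro: finite_subset le_trans[OF card_mono])
qed

section \<open>Polygonal lines\<close>

lemma list_induct_ge_2 [consumes 1, case_names pair Cons]:
  assumes "2 \<le> length xs" "\<And>x y. P [x, y]" "\<And>x xs. 2 \<le> length xs \<Longrightarrow> P xs \<Longrightarrow> P (x # xs)"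
  shows "P xs"
  using assms(1)
proof (induction xs)
  case (Cons x xs)
  show ?case
  proof (cases "2 \<le> length xs")
    case False
    then obtain y where "xs = [y]"
      using Cons.prems by (cases xs; cases "tl xs") auto
    then show ?thesis using assms(2) by simp
  qed (use Cons.IH assms(3) in blast)
qed simp

fun polyline :: "'b::real_normed_vector list \<Rightarrow> real \<Rightarrow> 'b" where
  "polyline [a, b] = linepath a b"
| "polyline (a # b # c # ps) = linepath a b +++ polyline (b # c # ps)"

lemma polyline_Cons: "2 \<le> length ps \<Longrightarrow> polyline (a # ps) = linepath a (hd ps) +++ polyline ps"
  by (cases ps rule: polyline.cases) auto

lemma pathstart_polyline: "2 \<le> length ps \<Longrightarrow> pathstart (polyline ps) = hd ps"
  by (induction ps rule: list_induct_ge_2) (simp_all add: polyline_Cons)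

lemma pathfinish_polyline: "2 \<le> length ps \<Longrightarrow> pathfinish (polyline ps) = last ps"
  by (induction ps rule: list_induct_ge_2) (auto simp: polyline_Cons)

lemma path_image_polyline_Cons:
  "2 \<le> length ps \<Longrightarrow> path_image (polyline (a # ps)) = closed_segment a (hd ps) \<union> path_image (polyline ps)"
  by (simp add: polyline_Cons path_image_join pathstart_polyline)

lemma arc_polyline_Cons:
  "2 \<le> length ps \<Longrightarrow> arc (polyline (a # ps)) \<longleftrightarrow>
     a \<noteq> hd ps \<and> arc (polyline ps) \<and> closed_segment a (hd ps) \<inter> path_image (polyline ps) \<subseteq> {hd ps}"
  by (auto simp: polyline_Cons arc_join_eq pathstart_polyline dest: arc_distinct_ends)

lemma path_image_polyline_join:
  assumes "2 \<le> length ps" "2 \<le> length qs" "last ps = hd qs"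
  shows "path_image (polyline (ps \<oplus> qs)) = path_image (polyline ps) \<union> path_image (polyline qs)"
  using assms(1,3)
proof (induction ps rule: list_induct_ge_2)
  case (pair a b)
  then have "[a, b] \<oplus> qs = a # qs"
    using assms(2) by (cases qs) (auto simp: vwalk_join_def)
  then show ?case
    using pair assms(2) by (simp add: path_image_polyline_Cons)
next
  case (Cons a ps)
  then have "ps \<noteq> []" "2 \<le> length (ps \<oplus> qs)"
    by (auto simp: vwalk_join_def)
  then show ?case
    using Cons by (simp add: path_image_polyline_Cons vwalk_join_hd' Un_assoc)
qed

lemma arc_polyline_join:
  assumes "2 \<le> length ps" "2 \<le> length qs" "last ps = hd qs"
    and "arc (polyline ps)" "arc (polyline qs)"
    and "path_image (polyline ps) \<inter> path_image (polyline qs) \<subseteq> {hd qs}"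
  shows "arc (polyline (ps \<oplus> qs))"
  using assms(1,3,4,6)
proof (induction ps rule: list_induct_ge_2)
  case (pair a b)
  then have "[a, b] \<oplus> qs = a # qs"
    using assms(2) by (cases qs) (auto simp: vwalk_join_def)
  moreover have "a \<noteq> b"
    using pair.prems arc_distinct_ends[of "linepath a b"] by simp
  ultimately show ?case
    using pair assms(2,5) by (simp add: arc_polyline_Cons)
next
  case (Cons a ps)
  have "ps \<noteq> []"
    using Cons.hyps by auto
  then have length: "2 \<le> length (ps \<oplus> qs)" and last: "last ps = hd qs"
    using Cons.hyps Cons.prems by (simp_all add: vwalk_join_def)
  have first_edge: "a \<noteq> hd ps" "closed_segment a (hd ps) \<inter> path_image (polyline ps) \<subseteq> {hd ps}"
    and arc: "arc (polyline ps)"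
    using Cons.hyps Cons.prems by (simp_all add: arc_polyline_Cons)
  have common: "closed_segment a (hd ps) \<inter> path_image (polyline qs) \<subseteq> {hd qs}"
    "path_image (polyline ps) \<inter> path_image (polyline qs) \<subseteq> {hd qs}"
    using Cons.hyps Cons.prems by (auto simp: path_image_polyline_Cons)
  have "hd qs \<in> path_image (polyline ps)"
    using last Cons.hyps pathfinish_in_path_image[of "polyline ps"] by (simp add: pathfinish_polyline)
  then have "closed_segment a (hd ps) \<inter> path_image (polyline (ps \<oplus> qs)) \<subseteq> {hd ps}"
    using first_edge(2) common(1) path_image_polyline_join[of ps qs] last Cons.hyps assms(2) by auto
  moreover have "arc (polyline (ps \<oplus> qs))"
    using last arc common(2) by (rule Cons.IH)
  ultimately show ?case
    using first_edge(1) length \<open>ps \<noteq> []\<close> by (simp add: arc_polyline_Cons vwalk_join_hd')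
qed

lemma polyline_along_segment:
  fixes f :: "nat \<Rightarrow> 'b::euclidean_space"
  assumes "i < j" "\<And>k. i \<le> k \<Longrightarrow> k < j \<Longrightarrow> f k \<noteq> f (Suc k)"
    and "\<And>k. i \<le> k \<Longrightarrow> k < j \<Longrightarrow> f (Suc k) \<in> closed_segment (f k) (f j)"
  shows "arc (polyline (map f [i..<Suc j])) \<and>
    path_image (polyline (map f [i..<Suc j])) = closed_segment (f i) (f j)"
  using assms
proof (induction i rule: strict_inc_induct)
  case (base i)
  then show ?case by (simp add: upt_conv_Cons)
next
  case (step i)
  let ?ps = "map f [Suc i..<Suc j]"
  have ps: "map f [i..<Suc j] = f i # ?ps" "2 \<le> length ?ps" "hd ?ps = f (Suc i)"
    using step.hyps by (simp_all add: upt_conv_Cons del: upt_Suc)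
  have IH: "arc (polyline ?ps)" "path_image (polyline ?ps) = closed_segment (f (Suc i)) (f j)"
    using step by simp_all
  have "f (Suc i) \<in> closed_segment (f i) (f j)" "f i \<noteq> f (Suc i)"
    using step by simp_all
  then show ?case
    unfolding ps(1) using ps(2,3) IH
    by (simp add: arc_polyline_Cons path_image_polyline_Cons Int_closed_segment Un_closed_segment)
qed

section \<open>Straight-line drawings\<close>

definition straight_edge :: "('b \<Rightarrow> real \<times> real) \<Rightarrow> 'b set \<Rightarrow> real \<Rightarrow> real \<times> real" where
  "straight_edge pos e = (SOME g. \<exists>x y. e = {x, y} \<and> g = linepath (pos x) (pos y))"

lemma straight_edge_cases:
  obtains "straight_edge pos {x, y} = linepath (pos x) (pos y)"
  | "straight_edge pos {x, y} = linepath (pos y) (pos x)"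
proof -
  have "\<exists>g x' y'. {x, y} = {x', y'} \<and> g = linepath (pos x') (pos y')"
    by blast
  then have "\<exists>x' y'. {x, y} = {x', y'} \<and> straight_edge pos {x, y} = linepath (pos x') (pos y')"
    unfolding straight_edge_def by (rule someI_ex)
  then show thesis
    using that by (auto simp: doubleton_eq_iff)
qed

lemma edge_curve_straight_edge: "edge_curve pos (straight_edge pos) x y = linepath (pos x) (pos y)"
  by (cases rule: straight_edge_cases[of pos x y]) (auto simp: edge_curve_def reversepath_linepath)

lemma path_curve_straight_edge:
  "2 \<le> length p \<Longrightarrow> path_curve pos (straight_edge pos) p = polyline (map pos p)"
  by (induction pos "straight_edge pos" p rule: path_curve.induct) (auto simp: edge_curve_straight_edge)

lemma is_drawing_straight_edge:
  assumes "pair_loopfree_digraph G" "inj_on pos (pverts G)"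
    and avoids: "\<And>u v w. \<lbrakk>(u, v) \<in> parcs G; w \<in> pverts G; pos w \<in> closed_segment (pos u) (pos v)\<rbrakk>
      \<Longrightarrow> w \<in> {u, v}"
  shows "is_drawing G pos (straight_edge pos)"
proof -
  have "arc (straight_edge pos {u, v}) \<and>
      {pathstart (straight_edge pos {u, v}), pathfinish (straight_edge pos {u, v})} = {pos u, pos v} \<and>
      (\<forall>w \<in> pverts G - {u, v}. pos w \<notin> path_image (straight_edge pos {u, v}))"
    if uv: "(u, v) \<in> parcs G" for u v
  proof -
    have "u \<in> pverts G" "v \<in> pverts G" "u \<noteq> v"
      using uv assms(1) pair_loopfree_digraph.pair_no_loops[of G "(u, v)"]
      by (auto dest: pair_loopfree_digraph.axioms(1) pair_wf_digraph.in_arcsD1 pair_wf_digraph.in_arcsD2)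
    then have "pos u \<noteq> pos v"
      using assms(2) by (auto dest: inj_onD)
    moreover have "path_image (straight_edge pos {u, v}) = closed_segment (pos u) (pos v)"
      by (cases rule: straight_edge_cases[of pos u v]) (auto simp: closed_segment_commute)
    ultimately show ?thesis
      using avoids[OF uv] by (cases rule: straight_edge_cases[of pos u v]) (auto simp: closed_segment_commute)
  qed
  then show ?thesis
    unfolding is_drawing_def case_prod_unfold using assms(2) by simp
qed

section \<open>Chords and legs in general position\<close>

lemma connected_Un_Int:
  assumes "connected (A \<inter> C)" "connected (B \<inter> C)" "B \<inter> C \<noteq> {} \<Longrightarrow> A \<inter> B \<inter> C \<noteq> {}"
  shows "connected ((A \<union> B) \<inter> C)"
proof (cases "B \<inter> C = {}")
  case False
  then have "(A \<inter> C) \<inter> (B \<inter> C) \<noteq> {}"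
    using assms(3) by blast
  then show ?thesis
    unfolding Int_Un_distrib2 using assms(1,2) by (intro connected_Un)
qed (use assms(1) in \<open>simp add: Int_Un_distrib2\<close>)

definition general_position :: "('a \<Rightarrow> 'b::euclidean_space) \<Rightarrow> 'a set \<Rightarrow> bool" where
  "general_position corner V \<longleftrightarrow> inj_on corner V \<and>
     (\<forall>u v w. {u, v, w} \<subseteq> V \<and> distinct [u, v, w] \<longrightarrow> \<not> collinear {corner u, corner v, corner w})"

locale corner_discs =
  fixes V :: "'a set" and corner :: "'a \<Rightarrow> 'b::euclidean_space" and \<rho> :: real
  assumes radius_pos: "0 < \<rho>"
    and general_position: "general_position corner V"
    and discs_disjoint: "\<lbrakk>{u, v} \<subseteq> V; u \<noteq> v\<rbrakk> \<Longrightarrow> cball (corner u) \<rho> \<inter> cball (corner v) \<rho> = {}"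
    and disc_chord_disjoint:
      "\<lbrakk>{u, x, y} \<subseteq> V; u \<notin> {x, y}\<rbrakk> \<Longrightarrow> cball (corner u) \<rho> \<inter> closed_segment (corner x) (corner y) = {}"

lemma general_position_notin_closed_segment:
  assumes "general_position corner V" "{u, x, y} \<subseteq> V" "u \<notin> {x, y}"
  shows "corner u \<notin> closed_segment (corner x) (corner y)"
proof (cases "x = y")
  case True
  then show ?thesis
    using assms by (auto simp: general_position_def dest: inj_onD)
next
  case False
  then have "{x, u, y} \<subseteq> V" "distinct [x, u, y]"
    using assms(2,3) by auto
  then have "\<not> collinear {corner x, corner u, corner y}"
    using assms(1) unfolding general_position_def by blast
  then show ?thesis
    using between_imp_collinear[of "corner x" "corner y" "corner u"] by (auto simp: between_mem_segment)
qed

lemma ex_clearance_from_chords: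
  fixes corner :: "'a \<Rightarrow> 'b::euclidean_space"
  assumes "finite V" "general_position corner V"
  obtains d where "0 < d"
    "\<And>u x y z. \<lbrakk>{u, x, y} \<subseteq> V; u \<notin> {x, y}; z \<in> closed_segment (corner x) (corner y)\<rbrakk>
      \<Longrightarrow> d \<le> dist (corner u) z"
proof -
  define other_chords where
    "other_chords u = (\<Union>(x, y)\<in>(V - {u}) \<times> (V - {u}). closed_segment (corner x) (corner y))" for u
  have "\<exists>e>0. \<forall>z\<in>other_chords u. e \<le> dist (corner u) z" if "u \<in> V" for u
  proof (rule separate_point_closed)
    show "closed (other_chords u)"
      unfolding other_chords_def using \<open>finite V\<close> by (intro closed_UN) (auto simp: closed_segment)
    show "corner u \<notin> other_chords u"
      using general_position_notin_closed_segment[OF assms(2)] \<open>u \<in> V\<close> by (auto simp: other_chords_def)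
  qed
  then obtain e where e_pos: "\<And>u. u \<in> V \<Longrightarrow> 0 < e u"
    and e_le: "\<And>u z. \<lbrakk>u \<in> V; z \<in> other_chords u\<rbrakk> \<Longrightarrow> e u \<le> dist (corner u) z"
    by metis
  show thesis
  proof
    show "0 < Min (insert 1 (e ` V))"
      using \<open>finite V\<close> e_pos by simp
    fix u x y z assume "{u, x, y} \<subseteq> V" "u \<notin> {x, y}" "z \<in> closed_segment (corner x) (corner y)"
    moreover from this have "e u \<le> dist (corner u) z"
      by (intro e_le) (auto simp: other_chords_def)
    ultimately show "Min (insert 1 (e ` V)) \<le> dist (corner u) z"
      using \<open>finite V\<close> by (simp add: Min_le_iff) blast
  qed
qed

lemma ex_corner_discs:
  fixes corner :: "'a \<Rightarrow> 'b::euclidean_space"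
  assumes "finite V" "general_position corner V"
  obtains \<rho> where "corner_discs V corner \<rho>"
proof -
  obtain d where "0 < d" and clearance:
    "\<And>u x y z. \<lbrakk>{u, x, y} \<subseteq> V; u \<notin> {x, y}; z \<in> closed_segment (corner x) (corner y)\<rbrakk>
      \<Longrightarrow> d \<le> dist (corner u) z"
    using ex_clearance_from_chords[OF assms] by blast
  have "corner_discs V corner (d / 3)"
  proof
    fix u v assume "{u, v} \<subseteq> V" "u \<noteq> v"
    then have "d \<le> dist (corner u) (corner v)"
      using clearance[of u v v "corner v"] by simp
    then show "cball (corner u) (d / 3) \<inter> cball (corner v) (d / 3) = {}"
      using \<open>0 < d\<close> by (intro disjoint_cballI) simp
  next
    fix u x y assume "{u, x, y} \<subseteq> V" "u \<notin> {x, y}"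
    then show "cball (corner u) (d / 3) \<inter> closed_segment (corner x) (corner y) = {}"
      using clearance[of u x y] \<open>0 < d\<close> by fastforce
  qed (use \<open>0 < d\<close> assms(2) in simp_all)
  then show thesis ..
qed

lemma parabola_noncollinear:
  fixes a b c :: real
  assumes "distinct [a, b, c]"
  shows "\<not> collinear {(a, a\<^sup>2), (b, b\<^sup>2), (c, c\<^sup>2)}"
proof
  assume "collinear {(a, a\<^sup>2), (b, b\<^sup>2), (c, c\<^sup>2)}"
  then obtain u where combination: "b = u * a + (1 - u) * c" "b\<^sup>2 = u * a\<^sup>2 + (1 - u) * c\<^sup>2"
    using assms by (auto simp: collinear_3_expand)
  have "(b - a) * (b - c) = b\<^sup>2 - (a + c) * b + a * c"
    by (simp add: algebra_simps power2_eq_square)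
  also have "\<dots> = 0"
    unfolding combination(2) by (subst combination(1)) (simp add: algebra_simps power2_eq_square)
  finally show False
    using assms by simp
qed

context corner_discs
begin

abbreviation disc :: "'a \<Rightarrow> 'b set" where
  "disc u \<equiv> cball (corner u) \<rho>"

abbreviation chord :: "'a \<Rightarrow> 'a \<Rightarrow> 'b set" where
  "chord u v \<equiv> closed_segment (corner u) (corner v)"

lemma corner_eq_iff: "\<lbrakk>u \<in> V; v \<in> V\<rbrakk> \<Longrightarrow> corner u = corner v \<longleftrightarrow> u = v"
  using general_position by (auto simp: general_position_def inj_on_eq_iff)

lemma disc_Int_chord: "\<lbrakk>{u, x, y} \<subseteq> V; disc u \<inter> chord x y \<noteq> {}\<rbrakk> \<Longrightarrow> u = x \<or> u = y"
  using disc_chord_disjoint by blast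

lemma adjacent_chords_Int:
  assumes "{u, v, w} \<subseteq> V" "distinct [u, v, w]"
  shows "chord u v \<inter> chord u w = {corner u}"
proof -
  have "{v, u, w} \<subseteq> V" "distinct [v, u, w]"
    using assms by auto
  then have "\<not> collinear {corner v, corner u, corner w}"
    using general_position unfolding general_position_def by blast
  then show ?thesis
    using Int_closed_segment[of "corner u" "corner v" "corner w"] by (simp add: closed_segment_commute)
qed

lemma radius_less_half_chord:
  assumes "u \<in> V" "v \<in> V" "u \<noteq> v"
  shows "\<rho> < dist (corner u) (corner v) / 2"
proof (rule ccontr)
  assume "\<not> \<rho> < dist (corner u) (corner v) / 2"
  then have "midpoint (corner u) (corner v) \<in> disc u \<inter> disc v"
    by (simp add: dist_midpoint)
  then show False
    using discs_disjoint[of u v] assms by blast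
qed

definition leg :: "'a \<Rightarrow> 'b set \<Rightarrow> bool" where
  "leg u L \<longleftrightarrow> convex L \<and> corner u \<in> L \<and> L \<subseteq> disc u"

definition chord_part :: "'a \<Rightarrow> 'a \<Rightarrow> 'b set \<Rightarrow> bool" where
  "chord_part u v S \<longleftrightarrow> convex S \<and> corner u \<in> S \<and> S \<subseteq> chord u v"

definition fork :: "'b set \<Rightarrow> bool" where
  "fork X \<longleftrightarrow> (\<exists>u v w S T. {u, v, w} \<subseteq> V \<and> distinct [u, v, w] \<and>
     chord_part u v S \<and> chord_part u w T \<and> X = S \<union> T)"

definition chord_with_legs :: "'b set \<Rightarrow> bool" where
  "chord_with_legs X \<longleftrightarrow> (\<exists>u v L M. {u, v} \<subseteq> V \<and> leg u L \<and> leg v M \<and> X = chord u v \<union> L \<union> M)"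

lemma leg_Int_chord: "\<lbrakk>{u, x, y} \<subseteq> V; leg u L; L \<inter> chord x y \<noteq> {}\<rbrakk> \<Longrightarrow> u = x \<or> u = y"
  using disc_Int_chord[of u x y] unfolding leg_def by blast

lemma leg_Int_leg: "\<lbrakk>{u, v} \<subseteq> V; leg u L; leg v M; L \<inter> M \<noteq> {}\<rbrakk> \<Longrightarrow> u = v"
  using discs_disjoint[of u v] unfolding leg_def by blast

lemma connected_leg_Int_fork:
  assumes "u \<in> V" "leg u L" "fork X"
  shows "connected (L \<inter> X)"
proof -
  obtain x y z S T where V: "{x, y, z} \<subseteq> V" "distinct [x, y, z]"
    and S: "chord_part x y S" and T: "chord_part x z T" and X: "X = S \<union> T"
    using \<open>fork X\<close> unfolding fork_def by blast
  have parts: "connected (L \<inter> S)" "connected (L \<inter> T)"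
    using assms(2) S T by (auto simp: leg_def chord_part_def intro: convex_connected convex_Int)
  show ?thesis
  proof (cases "u = x")
    case True
    then have "corner u \<in> (L \<inter> S) \<inter> (L \<inter> T)"
      using assms(2) S T by (simp add: leg_def chord_part_def)
    then show ?thesis
      unfolding X Int_Un_distrib using parts by (intro connected_Un) auto
  next
    case False
    then have "L \<inter> chord x y = {} \<or> L \<inter> chord x z = {}"
      using leg_Int_chord[of u x y L] leg_Int_chord[of u x z L] assms(1,2) V by auto
    then have "L \<inter> S = {} \<or> L \<inter> T = {}"
      using S T unfolding chord_part_def by blast
    then show ?thesis
      unfolding X Int_Un_distrib using parts by auto
  qed
qed

lemma leg_Int_chord_with_legs:
  assumes "{w, u, v} \<subseteq> V" "leg w N" "leg u L" "leg v M" "N \<inter> (chord u v \<union> L \<union> M) \<noteq> {}"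
  shows "w = u \<or> w = v"
proof -
  consider (chord) "N \<inter> chord u v \<noteq> {}" | (leg_u) "N \<inter> L \<noteq> {}" | (leg_v) "N \<inter> M \<noteq> {}"
    using assms(5) by blast
  then show ?thesis
  proof cases
    case chord
    with assms show ?thesis by (intro leg_Int_chord)
  next
    case leg_u
    with assms leg_Int_leg[of w u N L] show ?thesis by simp
  next
    case leg_v
    with assms leg_Int_leg[of w v N M] show ?thesis by simp
  qed
qed

lemma connected_chord_with_legs_Int_convex:
  assumes legs: "leg u L" "leg v M" and "convex B"
    and corner_in: "L \<inter> B \<noteq> {} \<Longrightarrow> corner u \<in> B" "M \<inter> B \<noteq> {} \<Longrightarrow> corner v \<in> B"
  shows "connected ((chord u v \<union> L \<union> M) \<inter> B)"
proof (rule connected_Un_Int)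
  have convex: "convex L" "convex M" and corners: "corner u \<in> L" "corner v \<in> M"
    using legs by (simp_all add: leg_def)
  have "connected (chord u v \<inter> B)" "connected (L \<inter> B)"
    using convex \<open>convex B\<close> by (auto intro!: convex_connected convex_Int)
  moreover have "chord u v \<inter> L \<inter> B \<noteq> {}" if "L \<inter> B \<noteq> {}"
    using corner_in(1)[OF that] corners(1) ends_in_segment(1) by blast
  ultimately show "connected ((chord u v \<union> L) \<inter> B)"
    by (rule connected_Un_Int)
  show "connected (M \<inter> B)"
    using convex(2) \<open>convex B\<close> by (intro convex_connected convex_Int)
  show "(chord u v \<union> L) \<inter> M \<inter> B \<noteq> {}" if "M \<inter> B \<noteq> {}"
    using corner_in(2)[OF that] corners(2) ends_in_segment(2) by blast
qed

lemma connected_leg_Int_chord_with_legs: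
  assumes V: "{w, u, v} \<subseteq> V" and legs: "leg w N" "leg u L" "leg v M"
  shows "connected (N \<inter> (chord u v \<union> L \<union> M))"
proof -
  have "connected ((chord u v \<union> L \<union> M) \<inter> N)"
  proof (rule connected_chord_with_legs_Int_convex[OF legs(2,3)])
    show "convex N" using legs(1) by (simp add: leg_def)
    show "corner u \<in> N" if "L \<inter> N \<noteq> {}"
      using leg_Int_leg[of u w L N] V legs that by (auto simp: leg_def)
    show "corner v \<in> N" if "M \<inter> N \<noteq> {}"
      using leg_Int_leg[of v w M N] V legs that by (auto simp: leg_def)
  qed
  then show ?thesis by (simp add: Int_commute)
qed

lemma connected_chords_with_legs_Int:
  assumes "chord_with_legs X" "chord_with_legs Y"
  shows "connected (X \<inter> Y)"
proof -
  obtain u v L M where V: "{u, v} \<subseteq> V" and legs: "leg u L" "leg v M" and X: "X = chord u v \<union> L \<union> M"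
    using assms(1) unfolding chord_with_legs_def by blast
  obtain u' v' L' M' where V': "{u', v'} \<subseteq> V" and legs': "leg u' L'" "leg v' M'"
    and Y: "Y = chord u' v' \<union> L' \<union> M'"
    using assms(2) unfolding chord_with_legs_def by blast
  have at_end: "chord u' v' \<inter> N \<inter> X \<noteq> {}" if w: "w = u' \<or> w = v'" "leg w N" "N \<inter> X \<noteq> {}" for w N
  proof -
    have "corner w \<in> chord u v"
      using leg_Int_chord_with_legs[of w u v N L M] w V V' legs by (auto simp: X)
    then show ?thesis
      using w(1,2) by (auto simp: X leg_def)
  qed
  have "connected ((chord u' v' \<union> L') \<inter> X)"
  proof (rule connected_Un_Int)
    have "connected (X \<inter> chord u' v')"
      unfolding X using legs leg_Int_chord[of u u' v' L] leg_Int_chord[of v u' v' M] V V'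
      by (intro connected_chord_with_legs_Int_convex) auto
    then show "connected (chord u' v' \<inter> X)"
      by (simp add: Int_commute)
    show "connected (L' \<inter> X)"
      unfolding X using connected_leg_Int_chord_with_legs[of u' u v L' L M] V V' legs legs' by simp
  qed (use at_end[of u'] legs' in blast)
  moreover have "connected (M' \<inter> X)"
    unfolding X using connected_leg_Int_chord_with_legs[of v' u v M' L M] V V' legs legs' by simp
  moreover have "(chord u' v' \<union> L') \<inter> M' \<inter> X \<noteq> {}" if "M' \<inter> X \<noteq> {}"
    using at_end[of v' M'] legs' that by blast
  ultimately have "connected (Y \<inter> X)"
    unfolding Y by (rule connected_Un_Int)
  then show ?thesis by (simp add: Int_commute)
qed

lemma fork_union_of_convex:
  assumes "fork X"
  shows "(at_most 2 union_of convex) X"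
proof -
  obtain S T where "convex S" "convex T" "X = S \<union> T"
    using assms unfolding fork_def chord_part_def by blast
  then show ?thesis
    using at_most_union_of_Un[of "Suc 0" convex S "Suc 0" T]
    by (simp add: at_most_Suc_0_union_of numeral_2_eq_2)
qed

lemma chord_with_legs_union_of_convex:
  assumes "chord_with_legs X"
  shows "(at_most 3 union_of convex) X"
proof -
  obtain u v L M where "convex L" "convex M" "X = chord u v \<union> L \<union> M"
    using assms unfolding chord_with_legs_def leg_def by blast
  then show ?thesis
    using at_most_union_of_Un[of "Suc 0 + Suc 0" convex "chord u v \<union> L" "Suc 0" M]
      at_most_union_of_Un[of "Suc 0" convex "chord u v" "Suc 0" L]
    by (simp add: at_most_Suc_0_union_of numeral_3_eq_3)
qed

lemma chord_with_legs_Int_fork: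
  assumes "chord_with_legs X" "fork Y"
  shows "(at_most 4 union_of connected) (X \<inter> Y)"
proof -
  obtain u v L M where V: "{u, v} \<subseteq> V" and legs: "leg u L" "leg v M" and X: "X = chord u v \<union> L \<union> M"
    using assms(1) unfolding chord_with_legs_def by blast
  have "(at_most 2 union_of connected) (chord u v \<inter> Y)"
    using at_most_Suc_0_union_of[of convex "chord u v"] fork_union_of_convex[OF assms(2)]
    by (intro union_of_convex_Int[of "Suc 0" _ 2]) simp_all
  moreover have "(at_most (Suc 0) union_of connected) (L \<inter> Y)" "(at_most (Suc 0) union_of connected) (M \<inter> Y)"
    using V legs connected_leg_Int_fork[OF _ _ assms(2)] by (auto intro: at_most_Suc_0_union_of)
  ultimately have "(at_most (2 + Suc 0 + Suc 0) union_of connected) (chord u v \<inter> Y \<union> L \<inter> Y \<union> M \<inter> Y)"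
    by (intro at_most_union_of_Un)
  then show ?thesis
    unfolding X Int_Un_distrib2 by simp
qed

definition bent_shape :: "'b set \<Rightarrow> bool" where
  "bent_shape X \<longleftrightarrow> convex X \<or> fork X \<or> chord_with_legs X"

lemma bent_shape_union_of_convex:
  assumes "bent_shape X"
  shows "(at_most 3 union_of convex) X"
proof -
  consider (convex) "convex X" | (fork) "fork X" | (legs) "chord_with_legs X"
    using assms unfolding bent_shape_def by blast
  then show ?thesis
  proof cases
    case convex
    then have "(at_most (Suc 0) union_of convex) X" by (rule at_most_Suc_0_union_of)
    then show ?thesis by (rule at_most_union_of_mono) simp
  next
    case fork
    then have "(at_most 2 union_of convex) X" by (rule fork_union_of_convex)
    then show ?thesis by (rule at_most_union_of_mono) simp
  qed (rule chord_with_legs_union_of_convex)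
qed

lemma bent_shapes_Int:
  assumes "bent_shape X" "bent_shape Y"
  shows "(at_most 4 union_of connected) (X \<inter> Y)"
proof -
  consider (convex_left) "convex X" | (convex_right) "convex Y" | (forks) "fork X" "fork Y"
    | (legs_fork) "chord_with_legs X" "fork Y" | (fork_legs) "fork X" "chord_with_legs Y"
    | (legs) "chord_with_legs X" "chord_with_legs Y"
    using assms unfolding bent_shape_def by blast
  then show ?thesis
  proof cases
    case convex_left
    then show ?thesis
      using at_most_Suc_0_union_of[of convex X] bent_shape_union_of_convex[OF assms(2)]
      by (intro union_of_convex_Int[of "Suc 0" _ 3]) simp_all
  next
    case convex_right
    then show ?thesis
      using at_most_Suc_0_union_of[of convex Y] bent_shape_union_of_convex[OF assms(1)]
      by (intro union_of_convex_Int[of 3 _ "Suc 0"]) simp_all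
  next
    case forks
    then show ?thesis
      by (intro union_of_convex_Int[of 2 _ 2]) (simp_all add: fork_union_of_convex)
  next
    case legs_fork
    then show ?thesis by (rule chord_with_legs_Int_fork)
  next
    case fork_legs
    then show ?thesis using chord_with_legs_Int_fork[of Y X] by (simp add: Int_commute)
  next
    case legs
    then have "(at_most (Suc 0) union_of connected) (X \<inter> Y)"
      by (intro at_most_Suc_0_union_of connected_chords_with_legs_Int)
    then show ?thesis by (rule at_most_union_of_mono) simp
  qed
qed

end

section \<open>Shortest paths in subdivided complete graphs\<close>

lemma length_vwalk_to_vpath: "length (vwalk_to_vpath p) \<le> length p"
  by (induct p rule: vwalk_to_vpath_induct3) (auto intro: order_trans length_dropWhile_le le_SucI)

lemma shortest_path_length_le:
  assumes "shortest_path G p" "vwalk q (with_proj G)" "hd q = hd p" "last q = last p"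
  shows "length p \<le> length q"
proof -
  have "vpath (vwalk_to_vpath q) (with_proj G)"
    using assms(2) by (rule vwalk_to_vpath_vpath)
  then have "vwalk_length p \<le> vwalk_length (vwalk_to_vpath q)"
    using assms(1,3,4) by (simp add: shortest_path_def vwalk_to_vpath_hd vwalk_to_vpath_last)
  then show ?thesis
    using length_vwalk_to_vpath[of q] assms(2) by (cases q) (auto simp: vwalk_def)
qed

lemma vwalk_append_iff:
  assumes "p \<noteq> []" "q \<noteq> []"
  shows "vwalk (p @ q) H \<longleftrightarrow> vwalk p H \<and> vwalk q H \<and> (last p, hd q) \<in> arcs_ends H"
  using assms by (auto simp: vwalk_def vwalk_arcs_append)

lemma shortest_path_suffix:
  assumes "shortest_path G (p @ q)" "q \<noteq> []"
  shows "shortest_path G q"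
proof (cases "p = []")
  case False
  then have p: "vwalk p (with_proj G)" "(last p, hd q) \<in> arcs_ends (with_proj G)"
    and q: "vpath q (with_proj G)"
    using assms by (simp_all add: shortest_path_def vpath_def vwalk_append_iff)
  have "vwalk_length q \<le> vwalk_length q'"
    if q': "vpath q' (with_proj G)" "hd q' = hd q" "last q' = last q" for q'
  proof -
    have walk: "vwalk q' (with_proj G)" "q' \<noteq> []"
      using q'(1) by (auto simp: vpath_def)
    have "vwalk (p @ q') (with_proj G)"
      using p walk q'(2) False by (simp add: vwalk_append_iff)
    then have "length (p @ q) \<le> length (p @ q')"
      using q'(2,3) walk(2) False \<open>q \<noteq> []\<close> by (intro shortest_path_length_le[OF assms(1)]) simp_all
    then show ?thesis by simp
  qed
  then show ?thesis
    using q by (simp add: shortest_path_def)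
qed (use assms in simp)

fun nonbacktracking :: "'a list \<Rightarrow> bool" where
  "nonbacktracking (u # v # w # us) \<longleftrightarrow> u \<noteq> v \<and> u \<noteq> w \<and> nonbacktracking (v # w # us)"
| "nonbacktracking [u, v] \<longleftrightarrow> u \<noteq> v"
| "nonbacktracking _ \<longleftrightarrow> True"

lemma nonbacktracking_imp_distinct_adj: "nonbacktracking us \<Longrightarrow> distinct_adj us"
  by (induction us rule: nonbacktracking.induct) auto

locale complete_subdivision =
  fixes n t :: nat and K :: "'a::linorder pair_pre_digraph"
  assumes complete: "complete_digraph n (with_proj K)"
begin

abbreviation V :: "'a set" where
  "V \<equiv> pverts K"

abbreviation G :: "'a sd_vertex pair_pre_digraph" where
  "G \<equiv> subdivide_all t K"

lemma parcs_K: "parcs K = {(u, v). u \<in> V \<and> v \<in> V \<and> u \<noteq> v}"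
  using complete by (auto simp: complete_digraph_pair_def)

lemma finite_V: "finite V"
  using complete by (simp add: complete_digraph_pair_def)

lemma pair_graph_G: "pair_graph G"
proof (rule pair_graph_subdivide_all)
  have "finite (parcs K)"
    using finite_V by (auto simp: parcs_K intro: finite_subset[of _ "V \<times> V"])
  then show "pair_graph K"
    using finite_V by unfold_locales (auto simp: parcs_K symmetric_def sym_def)
qed

text \<open>The \<open>k\<close>-th vertex on the edge \<open>uv\<close> counted from \<open>u\<close>, for either order of \<open>u\<close> and \<open>v\<close>.\<close>

definition edge_vertex :: "'a \<Rightarrow> 'a \<Rightarrow> nat \<Rightarrow> 'a sd_vertex" where
  "edge_vertex u v k = (if u < v then sd_point t u v k else sd_point t v u (Suc t - k))"

lemma edge_vertex_0: "u \<noteq> v \<Longrightarrow> edge_vertex u v 0 = Branch u"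
  and edge_vertex_end: "u \<noteq> v \<Longrightarrow> edge_vertex u v (Suc t) = Branch v"
  by (auto simp: edge_vertex_def sd_point_def)

lemma edge_vertex_inner:
  "0 < k \<Longrightarrow> k \<le> t \<Longrightarrow> edge_vertex u v k = (if u < v then Inner u v k else Inner v u (Suc t - k))"
  by (auto simp: edge_vertex_def sd_point_def)

lemma edge_vertex_swap: "u \<noteq> v \<Longrightarrow> k \<le> Suc t \<Longrightarrow> edge_vertex v u (Suc t - k) = edge_vertex u v k"
  by (auto simp: edge_vertex_def)

lemma edge_vertex_cases:
  assumes "u \<noteq> v" "k \<le> Suc t"
  obtains (first) "k = 0" "edge_vertex u v k = Branch u"
  | (last) "k = Suc t" "edge_vertex u v k = Branch v"
  | (inner) "0 < k" "k \<le> t" "edge_vertex u v k = (if u < v then Inner u v k else Inner v u (Suc t - k))"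
  using assms edge_vertex_0 edge_vertex_end edge_vertex_inner by (metis le_SucE neq0_conv)

lemma edge_vertex_eq_innerD:
  assumes "0 < k" "k \<le> t" "u \<noteq> v" "x \<noteq> y" "l \<le> Suc t" "edge_vertex u v k = edge_vertex x y l"
  shows "x = u \<and> y = v \<and> l = k \<or> x = v \<and> y = u \<and> l = Suc t - k"
  using assms(4,5)
  by (cases rule: edge_vertex_cases) (use assms in \<open>auto simp: edge_vertex_inner split: if_splits\<close>)

lemma edge_vertex_in_verts:
  assumes "u \<in> V" "v \<in> V" "u \<noteq> v" "k \<le> Suc t"
  shows "edge_vertex u v k \<in> pverts G"
  using assms(3,4) by (cases rule: edge_vertex_cases) (use assms in \<open>auto simp: subdivide_all_def parcs_K\<close>)

lemma verts_G_cases: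
  assumes "x \<in> pverts G"
  obtains (branch) u where "u \<in> V" "x = Branch u"
  | (inner) u v k where "u \<in> V" "v \<in> V" "u \<noteq> v" "0 < k" "k \<le> t" "x = edge_vertex u v k"
proof -
  consider u where "u \<in> V" "x = Branch u"
    | u v k where "u \<in> V" "v \<in> V" "u < v" "0 < k" "k \<le> t" "x = Inner u v k"
    using assms by (auto simp: subdivide_all_def parcs_K)
  then show thesis
    by cases (use that in \<open>auto simp: edge_vertex_inner\<close>)
qed

lemma edge_vertex_arc:
  assumes "u \<in> V" "v \<in> V" "u \<noteq> v" "k \<le> t"
  shows "(edge_vertex u v k, edge_vertex u v (Suc k)) \<in> parcs G"
proof -
  have ascending: "(sd_point t a b l, sd_point t a b (Suc l)) \<in> parcs G"
      "(sd_point t a b (Suc l), sd_point t a b l) \<in> parcs G"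
    if "a \<in> V" "b \<in> V" "a < b" "l \<le> t" for a b l
    using that by (fastforce simp: subdivide_all_def parcs_K Let_def)+
  show ?thesis
    using assms ascending(1)[of u v k] ascending(2)[of v u "t - k"]
    by (cases u v rule: linorder_cases) (auto simp: edge_vertex_def Suc_diff_le)
qed

lemma parcs_G_cases:
  assumes "(x, y) \<in> parcs G"
  obtains u v k where "u \<in> V" "v \<in> V" "u \<noteq> v" "k \<le> t" "x = edge_vertex u v k" "y = edge_vertex u v (Suc k)"
proof -
  obtain u v k where uv: "u \<in> V" "v \<in> V" "u < v" "k \<le> t"
    and "x = edge_vertex u v k \<and> y = edge_vertex u v (Suc k) \<or> y = edge_vertex u v k \<and> x = edge_vertex u v (Suc k)"
    using assms by (auto simp: subdivide_all_def parcs_K Let_def edge_vertex_def)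
  moreover have "edge_vertex u v (Suc k) = edge_vertex v u (t - k)" "edge_vertex u v k = edge_vertex v u (Suc (t - k))"
    using uv edge_vertex_swap[of u v "Suc k"] edge_vertex_swap[of u v k] by (simp_all add: Suc_diff_le)
  ultimately show thesis
    using that[of u v k] that[of v u "t - k"] by auto
qed

lemma arc_to_inner:
  assumes "(x, edge_vertex u v i) \<in> parcs G" "u \<noteq> v" "0 < i" "i \<le> t"
  shows "x = edge_vertex u v (i - 1) \<or> x = edge_vertex u v (Suc i)"
proof -
  obtain a b k where "a \<noteq> b" "k \<le> t" and x: "x = edge_vertex a b k"
    and next_vertex: "edge_vertex u v i = edge_vertex a b (Suc k)"
    using assms(1) by (rule parcs_G_cases)
  consider (forward) "a = u" "b = v" "Suc k = i" | (backward) "a = v" "b = u" "Suc k = Suc t - i"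
    using edge_vertex_eq_innerD[OF assms(3,4,2) \<open>a \<noteq> b\<close> _ next_vertex] \<open>k \<le> t\<close> by auto
  then show ?thesis
  proof cases
    case forward
    then show ?thesis using x by auto
  next
    case backward
    then have "k = Suc t - Suc i" by simp
    then show ?thesis
      using backward x edge_vertex_swap[of u v "Suc i"] assms by simp
  qed
qed

lemma arc_to_branch:
  assumes "(x, Branch u) \<in> parcs G"
  obtains w where "w \<in> V" "w \<noteq> u" "x = edge_vertex w u t"
proof -
  obtain a b k where arc: "a \<in> V" "a \<noteq> b" "k \<le> t" "x = edge_vertex a b k"
    and branch: "Branch u = edge_vertex a b (Suc k)"
    using assms by (rule parcs_G_cases)
  have "Suc k \<le> Suc t" using \<open>k \<le> t\<close> by simp
  with \<open>a \<noteq> b\<close> have "Suc k = Suc t \<and> b = u"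
    by (cases rule: edge_vertex_cases) (use branch in \<open>auto split: if_splits\<close>)
  then show thesis using that arc by auto
qed

definition run :: "'a \<Rightarrow> 'a \<Rightarrow> nat \<Rightarrow> nat \<Rightarrow> 'a sd_vertex list" where
  "run u v i j = map (edge_vertex u v) [i..<Suc j]"

lemma run_self [simp]: "run u v i i = [edge_vertex u v i]"
  by (simp add: run_def)

lemma run_Cons: "i < j \<Longrightarrow> run u v i j = edge_vertex u v i # run u v (Suc i) j"
  by (simp add: run_def upt_conv_Cons del: upt_Suc)

lemma run_eq_Nil_iff [simp]: "run u v i j = [] \<longleftrightarrow> j < i"
  by (auto simp: run_def)

lemma hd_run [simp]: "i \<le> j \<Longrightarrow> hd (run u v i j) = edge_vertex u v i"
  by (simp add: run_def upt_conv_Cons del: upt_Suc)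

lemma last_run [simp]: "i \<le> j \<Longrightarrow> last (run u v i j) = edge_vertex u v j"
  by (simp add: run_def)

lemma length_run [simp]: "length (run u v i j) = Suc j - i"
  by (simp add: run_def del: upt_Suc)

lemma edge_vertex_in_run: "i \<le> k \<Longrightarrow> k \<le> j \<Longrightarrow> edge_vertex u v k \<in> set (run u v i j)"
  by (auto simp: run_def simp del: upt_Suc)

lemma vwalk_run:
  assumes "u \<in> V" "v \<in> V" "u \<noteq> v" "i \<le> j" "j \<le> Suc t"
  shows "vwalk (run u v i j) (with_proj G)"
  using \<open>i \<le> j\<close>
proof (induction i rule: inc_induct)
  case base
  then show ?case using edge_vertex_in_verts[of u v j] assms by simp
next
  case (step k)
  then show ?case
    using assms edge_vertex_arc[of u v k] edge_vertex_in_verts[of u v k]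
    by (auto simp: run_Cons intro!: vwalk_consI)
qed

fun route :: "nat \<Rightarrow> nat \<Rightarrow> 'a list \<Rightarrow> 'a sd_vertex list" where
  "route i j [u, v] = run u v i j"
| "route i j (u # v # w # us) = run u v i (Suc t) \<oplus> route 0 j (v # w # us)"

lemmas route_induct = route.induct[case_names edge turn empty singleton]

definition valid_route :: "nat \<Rightarrow> nat \<Rightarrow> 'a list \<Rightarrow> bool" where
  "valid_route i j us \<longleftrightarrow> set us \<subseteq> V \<and> nonbacktracking us \<and> 2 \<le> length us \<and>
     i \<le> t \<and> 0 < j \<and> j \<le> Suc t \<and> (length us = 2 \<longrightarrow> i < j)"

lemma hd_route:
  assumes "i \<le> Suc t" "us = [] \<Longrightarrow> i \<le> j"
  shows "hd (route i j (u # v # us)) = edge_vertex u v i"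
  using assms by (cases us) (simp_all add: vwalk_join_hd')

lemma route_neq_Nil:
  assumes "i \<le> Suc t" "us = [] \<Longrightarrow> i \<le> j"
  shows "route i j (u # v # us) \<noteq> []"
  using assms by (cases us) simp_all

lemma joinable_run_route:
  assumes "u \<noteq> v" "v \<noteq> w" "i \<le> Suc t"
  shows "joinable (run u v i (Suc t)) (route 0 j (v # w # us))"
  using assms by (intro joinableI) (simp_all add: hd_route route_neq_Nil edge_vertex_0 edge_vertex_end)

lemma vwalk_route:
  assumes "set us \<subseteq> V" "distinct_adj us" "2 \<le> length us" "i \<le> Suc t" "j \<le> Suc t" "length us = 2 \<Longrightarrow> i \<le> j"
  shows "vwalk (route i j us) (with_proj G)"
  using assms
proof (induction i j us rule: route_induct)
  case (edge i j u v)
  then show ?case by (simp add: vwalk_run)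
next
  case (turn i j u v w us)
  then have "vwalk (route 0 j (v # w # us)) (with_proj G)"
    by simp
  then show ?case
    using turn by (auto intro!: vwalk_joinI_vwalk vwalk_run joinable_run_route simp del: route.simps(1))
qed auto

lemma last_route:
  assumes "distinct_adj us" "2 \<le> length us" "i \<le> Suc t" "length us = 2 \<Longrightarrow> i \<le> j"
  shows "last (route i j us) = edge_vertex (last (butlast us)) (last us) j"
  using assms
proof (induction i j us rule: route_induct)
  case (turn i j u v w us)
  then show ?case
    using joinable_run_route[of u v w i j us] by (simp add: vwalk_join_last del: route.simps(1))
qed auto

lemma length_route:
  assumes "distinct_adj us" "2 \<le> length us" "i \<le> Suc t" "length us = 2 \<Longrightarrow> i \<le> j"
  shows "length (route i j us) = Suc ((length us - 2) * Suc t + j) - i"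
  using assms
  by (induction i j us rule: route_induct) (auto simp: vwalk_join_def)

lemma Cons_route:
  assumes "i \<le> t" "us = [] \<Longrightarrow> i < j"
  shows "edge_vertex u v i # route (Suc i) j (u # v # us) = route i j (u # v # us)"
  using assms by (cases us) (simp_all add: run_Cons)

lemma edge_vertex_in_route:
  assumes "i \<le> k" "k \<le> Suc t" "us = [] \<Longrightarrow> k \<le> j"
  shows "edge_vertex u v k \<in> set (route i j (u # v # us))"
  using assms edge_vertex_in_run by (cases us) (simp_all add: vwalk_join_def)

lemma vpath_Cons_routeD:
  assumes path: "vpath (x # route i j (u # v # us)) (with_proj G)" and valid: "valid_route i j (u # v # us)"
  shows "(x, edge_vertex u v i) \<in> parcs G" "x \<noteq> edge_vertex u v (Suc i)"
proof -
  let ?p = "route i j (u # v # us)"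
  have bounds: "i \<le> t" "us = [] \<Longrightarrow> Suc i \<le> j"
    using valid by (auto simp: valid_route_def)
  have "hd ?p = edge_vertex u v i"
    using bounds by (intro hd_route) auto
  moreover have "?p \<noteq> []"
    using bounds by (intro route_neq_Nil) auto
  ultimately show "(x, edge_vertex u v i) \<in> parcs G"
    using path by (auto simp: vpath_def elim: vwalk_consE)
  have "edge_vertex u v (Suc i) \<in> set ?p"
    using bounds by (intro edge_vertex_in_route) auto
  then show "x \<noteq> edge_vertex u v (Suc i)"
    using path by (auto simp: vpath_def)
qed

lemma Cons_route_new_edge:
  assumes "u \<noteq> v" "u \<noteq> w" "us = [] \<Longrightarrow> 0 < j"
  shows "edge_vertex w u t # route 0 j (u # v # us) = route t j (w # u # v # us)"
proof -
  have "hd (route 0 j (u # v # us)) = Branch u" "route 0 j (u # v # us) \<noteq> []"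
    using assms by (simp_all add: hd_route route_neq_Nil edge_vertex_0)
  then have "route 0 j (u # v # us) = Branch u # tl (route 0 j (u # v # us))"
    by (metis list.collapse)
  then show ?thesis
    using assms by (simp add: run_Cons vwalk_join_def edge_vertex_end)
qed

lemma vpath_Cons_route:
  assumes path: "vpath (x # route i j us) (with_proj G)" and valid: "valid_route i j us"
  obtains i' us' where "valid_route i' j us'" "x # route i j us = route i' j us'"
proof -
  obtain u v us' where us: "us = u # v # us'"
    using valid by (auto simp: valid_route_def Suc_le_length_iff numeral_2_eq_2)
  have bounds: "i \<le> t" "us' = [] \<Longrightarrow> i < j" and "u \<noteq> v"
    using valid nonbacktracking_imp_distinct_adj[of us] by (auto simp: valid_route_def us)
  note x = vpath_Cons_routeD[OF path[unfolded us] valid[unfolded us]]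
  show thesis
  proof (cases i)
    case (Suc k)
    then have x_eq: "x = edge_vertex u v k"
      using arc_to_inner[OF x(1) \<open>u \<noteq> v\<close>] x(2) bounds by auto
    show thesis
    proof (rule that)
      show "valid_route k j us"
        using valid Suc by (auto simp: valid_route_def)
      show "x # route i j us = route k j us"
        unfolding us x_eq Suc using bounds Suc by (intro Cons_route) auto
    qed
  next
    case 0
    then obtain w where w: "w \<in> V" "w \<noteq> u" and x_eq: "x = edge_vertex w u t"
      using x(1) \<open>u \<noteq> v\<close> by (auto simp: edge_vertex_0 elim: arc_to_branch)
    have "w \<noteq> v"
      using x(2) x_eq \<open>u \<noteq> v\<close> 0 edge_vertex_swap[of u v 1] by auto
    show thesis
    proof (rule that)
      show "valid_route t j (w # us)"
        using valid w \<open>w \<noteq> v\<close> by (simp add: valid_route_def us)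
      show "x # route i j us = route t j (w # us)"
        unfolding us x_eq 0 using \<open>u \<noteq> v\<close> w(2) bounds 0 by (intro Cons_route_new_edge) auto
    qed
  qed
qed

lemma vpath_imp_route:
  assumes "vpath p (with_proj G)" "2 \<le> length p"
  shows "\<exists>us i j. valid_route i j us \<and> p = route i j us"
  using assms(2,1)
proof (induction p rule: list_induct_ge_2)
  case (pair x y)
  then have "(x, y) \<in> parcs G"
    by (auto simp: vpath_def vwalk_def)
  then obtain u v k where "u \<in> V" "v \<in> V" "u \<noteq> v" "k \<le> t" "x = edge_vertex u v k" "y = edge_vertex u v (Suc k)"
    by (rule parcs_G_cases)
  then have "valid_route k (Suc k) [u, v]" "[x, y] = route k (Suc k) [u, v]"
    by (simp_all add: valid_route_def run_Cons)
  then show ?case by blast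
next
  case (Cons x p)
  then have "vpath p (with_proj G)"
    by (auto simp: vpath_def elim: vwalk_consE)
  then obtain us i j where valid: "valid_route i j us" and p: "p = route i j us"
    using Cons.IH by blast
  have "vpath (x # route i j us) (with_proj G)"
    using Cons.prems p by simp
  then obtain i' us' where "valid_route i' j us'" "x # route i j us = route i' j us'"
    using valid by (rule vpath_Cons_route)
  then show ?case
    unfolding p by metis
qed

text \<open>If the path starts nearer to \<open>w\<close> than to \<open>u\<close>, it is shorter to walk back to \<open>w\<close> and take the edge \<open>wv\<close>;
  symmetrically at the other end.\<close>

lemma shortest_route_legs:
  assumes shortest: "shortest_path G (route i j [w, u, v, z])" and valid: "valid_route i j [w, u, v, z]"
  shows "Suc t \<le> 2 * i" "2 * j \<le> Suc t"
proof -
  let ?p = "route i j [w, u, v, z]"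
  have V: "{w, u, v, z} \<subseteq> V" and distinct: "w \<noteq> u" "w \<noteq> v" "u \<noteq> v" "u \<noteq> z" "v \<noteq> z"
    and bounds: "i \<le> t" "j \<le> Suc t"
    using valid by (auto simp: valid_route_def)
  have ends: "hd ?p = edge_vertex w u i" "last ?p = edge_vertex v z j"
    and length: "length ?p = Suc (2 * Suc t + j) - i"
    using distinct bounds hd_route[of i "[v, z]" j w u] last_route[of "[w, u, v, z]" i j]
      length_route[of "[w, u, v, z]" i j] by simp_all
  have detour: "length ?p \<le> length (route i' j' us)"
    if "us \<in> {[u, w, v, z], [w, u, z, v]}" "hd (route i' j' us) = hd ?p" "last (route i' j' us) = last ?p"
      "i' \<le> Suc t" "j' \<le> Suc t" for i' j' us
    using that V distinct by (intro shortest_path_length_le[OF shortest] vwalk_route) auto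
  show "Suc t \<le> 2 * i"
  proof -
    have "length ?p \<le> length (route (Suc t - i) j [u, w, v, z])"
      using distinct bounds ends hd_route[of "Suc t - i" "[v, z]" j u w]
        last_route[of "[u, w, v, z]" "Suc t - i" j] edge_vertex_swap[of w u i]
      by (intro detour) simp_all
    also have "\<dots> = Suc (2 * Suc t + j) - (Suc t - i)"
      using distinct length_route[of "[u, w, v, z]" "Suc t - i" j] by simp
    finally show ?thesis using length bounds by simp
  qed
  show "2 * j \<le> Suc t"
  proof -
    have "length ?p \<le> length (route i (Suc t - j) [w, u, z, v])"
      using distinct bounds ends hd_route[of i "[z, v]" "Suc t - j" w u]
        last_route[of "[w, u, z, v]" i "Suc t - j"] edge_vertex_swap[of v z j]
      by (intro detour) simp_all
    also have "\<dots> = Suc (2 * Suc t + (Suc t - j)) - i"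
      using distinct bounds length_route[of "[w, u, z, v]" i "Suc t - j"] by simp
    finally show ?thesis using length bounds by simp
  qed
qed

lemma shortest_route_length:
  assumes "shortest_path G (route i j us)" "valid_route i j us"
  shows "length us \<le> 4"
  using assms
proof (induction i j us rule: route_induct)
  case (turn i j u v w us)
  show ?case
  proof (rule ccontr)
    assume long: "\<not> length (u # v # w # us) \<le> 4"
    have "u \<noteq> v" "v \<noteq> w" "i \<le> Suc t"
      using nonbacktracking_imp_distinct_adj[of "u # v # w # us"] turn.prems(2)
      by (auto simp: valid_route_def)
    then have "joinable (run u v i (Suc t)) (route 0 j (v # w # us))"
      by (rule joinable_run_route)
    then have rest: "shortest_path G (route 0 j (v # w # us))"
      using turn.prems(1) route_neq_Nil[of 0 us j v w]
      by (auto simp: vwalk_join_def2 intro: shortest_path_suffix)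
    have valid: "valid_route 0 j (v # w # us)"
      using turn.prems(2) long by (auto simp: valid_route_def)
    then have "length (v # w # us) = 4"
      using turn.IH[OF rest] long by simp
    then obtain x y where "us = [x, y]"
      by (auto simp: length_Suc_conv numeral_2_eq_2)
    then show False
      using shortest_route_legs(1)[of 0 j v w x y] rest valid by simp
  qed
qed (auto simp: valid_route_def)

lemma shortest_path_cases:
  assumes "shortest_path G p" "2 \<le> length p"
  obtains (one_edge) u v i j where "{u, v} \<subseteq> V" "u \<noteq> v" "i < j" "j \<le> Suc t" "p = route i j [u, v]"
  | (two_edges) u v w i j where "{u, v, w} \<subseteq> V" "distinct [u, v, w]"
      "i \<le> t" "0 < j" "j \<le> Suc t" "p = route i j [u, v, w]"
  | (three_edges) u v w z i j where "{u, v, w, z} \<subseteq> V" "distinct [u, v, w]" "distinct [v, w, z]"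
      "i \<le> t" "0 < j" "Suc t \<le> 2 * i" "2 * j \<le> Suc t" "p = route i j [u, v, w, z]"
proof -
  have "vpath p (with_proj G)"
    using assms(1) by (simp add: shortest_path_def)
  then obtain us i j where valid: "valid_route i j us" and p: "p = route i j us"
    using vpath_imp_route[OF _ assms(2)] by blast
  obtain u v us' where us: "us = u # v # us'"
    using valid by (auto simp: valid_route_def Suc_le_length_iff numeral_2_eq_2)
  have "length us' \<le> 2"
    using valid shortest_route_length[of i j us] assms(1) by (simp add: p us)
  then consider (one) "us' = []" | (two) w where "us' = [w]" | (three) w z where "us' = [w, z]"
    by (cases us'; cases "tl us'") auto
  then show thesis
  proof cases
    case one
    then show ?thesis using one_edge[of u v i j] valid p us by (simp add: valid_route_def)
  next
    case (two w)
    then show ?thesis using two_edges[of u v w i j] valid p us by (simp add: valid_route_def)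
  next
    case (three w z)
    then show ?thesis
      using three_edges[of u v w z i j] shortest_route_legs[of i j u v w z] valid p us assms(1)
      by (simp add: valid_route_def)
  qed
qed

end

section \<open>Drawing subdivided complete graphs\<close>

lemma linepath_swap: "linepath b a (1 - s) = linepath a b s"
  by (simp add: linepath_def)

lemma linepath_eq_iff: "a \<noteq> b \<Longrightarrow> linepath a b r = linepath a b s \<longleftrightarrow> r = s"
proof
  assume "a \<noteq> b" "linepath a b r = linepath a b s"
  moreover have "linepath a b r - linepath a b s = (r - s) *\<^sub>R (b - a)"
    by (simp add: linepath_def algebra_simps)
  ultimately show "r = s" by simp
qed simp

lemma closed_segment_linepath:
  "closed_segment (linepath a b r) (linepath a b s) = linepath a b ` closed_segment r s"
proof -
  have "linepath (linepath a b r) (linepath a b s) = (\<lambda>l. linepath a b (linepath r s l))"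
    by (rule ext) (simp add: linepath_def algebra_simps)
  then show ?thesis
    by (simp add: linepath_image_01[symmetric] image_image)
qed

text \<open>Relative positions on an edge: for even \<open>t\<close> every vertex has a nearer end and lies within \<open>\<delta>\<close> of it.\<close>

definition placement :: "nat \<Rightarrow> real \<Rightarrow> nat \<Rightarrow> real" where
  "placement t \<delta> k =
     (if 2 * k \<le> t then \<delta> * real k / real (Suc t) else 1 - \<delta> * (real (Suc t) - real k) / real (Suc t))"

lemma placement_0: "placement t \<delta> 0 = 0"
  and placement_end: "placement t \<delta> (Suc t) = 1"
  by (auto simp: placement_def)

lemma placement_mirror:
  assumes "even t" "k \<le> Suc t"
  shows "placement t \<delta> (Suc t - k) = 1 - placement t \<delta> k"
proof -
  have "2 * (Suc t - k) \<le> t \<longleftrightarrow> \<not> 2 * k \<le> t"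
    using assms by (auto elim!: evenE)
  then show ?thesis
    using assms by (simp add: placement_def of_nat_diff)
qed

lemma placement_near_0:
  assumes "0 \<le> \<delta>" "2 * k \<le> t"
  shows "0 \<le> placement t \<delta> k" "placement t \<delta> k \<le> \<delta>"
proof -
  have "\<delta> * real k \<le> \<delta> * real (Suc t)"
    using assms by (intro mult_left_mono) auto
  then show "0 \<le> placement t \<delta> k" "placement t \<delta> k \<le> \<delta>"
    using assms by (simp_all add: placement_def field_simps)
qed

lemma placement_strict_mono:
  assumes \<delta>: "0 < \<delta>" "\<delta> < 1/2" and "k < l" "l \<le> Suc t"
  shows "placement t \<delta> k < placement t \<delta> l"
proof -
  consider (near_0) "2 * l \<le> t" | (across) "2 * k \<le> t" "\<not> 2 * l \<le> t" | (near_1) "\<not> 2 * k \<le> t"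
    by linarith
  then show ?thesis
  proof cases
    case across
    have "\<delta> * (real (Suc t) - real l) \<le> \<delta> * real (Suc t)"
      using \<delta>(1) by (intro mult_left_mono) auto
    then have "1 - \<delta> \<le> placement t \<delta> l"
      using across by (simp add: placement_def field_simps)
    moreover have "placement t \<delta> k \<le> \<delta>"
      using across \<delta>(1) by (intro placement_near_0) auto
    ultimately show ?thesis
      using \<delta>(2) by linarith
  qed (use assms(3,4) \<delta>(1) in \<open>simp_all add: placement_def divide_strict_right_mono\<close>)
qed

locale subdivision_drawing = complete_subdivision n t K + corner_discs "pverts K" corner \<rho>
  for n t and K :: "'a::linorder pair_pre_digraph" and corner :: "'a \<Rightarrow> real \<times> real" and \<rho> +
  assumes even_t: "even t"
begin

definition param :: "'a \<Rightarrow> 'a \<Rightarrow> nat \<Rightarrow> real" where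
  "param u v k = placement t (\<rho> / dist (corner u) (corner v)) k"

fun pos :: "'a sd_vertex \<Rightarrow> real \<times> real" where
  "pos (Branch u) = corner u"
| "pos (Inner u v k) = linepath (corner u) (corner v) (param u v k)"

lemma param_0 [simp]: "param u v 0 = 0" and param_end [simp]: "param u v (Suc t) = 1"
  by (simp_all add: param_def placement_0 placement_end)

lemma param_swap: "k \<le> Suc t \<Longrightarrow> param v u (Suc t - k) = 1 - param u v k"
  by (simp only: param_def dist_commute[of "corner v"] placement_mirror[OF even_t])

lemma param_less_iff:
  assumes "u \<in> V" "v \<in> V" "u \<noteq> v" "k \<le> Suc t" "l \<le> Suc t"
  shows "param u v k < param u v l \<longleftrightarrow> k < l"
proof -
  let ?\<delta> = "\<rho> / dist (corner u) (corner v)"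
  have "0 < dist (corner u) (corner v)"
    using assms corner_eq_iff by simp
  then have \<delta>: "0 < ?\<delta>" "?\<delta> < 1/2"
    using radius_pos radius_less_half_chord[of u v] assms by (simp_all add: field_simps)
  show ?thesis
    unfolding param_def using placement_strict_mono[OF \<delta>] assms(4,5) by (metis linorder_neqE_nat order_less_asym)
qed

lemma param_le_iff:
  assumes "u \<in> V" "v \<in> V" "u \<noteq> v" "k \<le> Suc t" "l \<le> Suc t"
  shows "param u v k \<le> param u v l \<longleftrightarrow> k \<le> l"
  using param_less_iff[of u v l k] assms by (simp add: not_less[symmetric])

lemma pos_edge_vertex:
  assumes "u \<noteq> v" "k \<le> Suc t"
  shows "pos (edge_vertex u v k) = linepath (corner u) (corner v) (param u v k)"
  using assms
proof (cases rule: edge_vertex_cases)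
  case inner
  then show ?thesis
    using linepath_swap[of "corner v" "corner u" "param u v k"] param_swap[of k v u] by auto
qed (simp_all add: linepath_def)

lemma pos_edge_vertex_eq_iff:
  assumes "u \<in> V" "v \<in> V" "u \<noteq> v" "k \<le> Suc t" "l \<le> Suc t"
  shows "pos (edge_vertex u v k) = pos (edge_vertex u v l) \<longleftrightarrow> k = l"
  using assms corner_eq_iff[of u v] param_le_iff[of u v k l] param_le_iff[of u v l k]
  by (auto simp: pos_edge_vertex linepath_eq_iff)

lemma pos_edge_vertex_between_iff:
  assumes "u \<in> V" "v \<in> V" "u \<noteq> v" "i \<le> j" "j \<le> Suc t" "k \<le> Suc t"
  shows "pos (edge_vertex u v k) \<in> closed_segment (pos (edge_vertex u v i)) (pos (edge_vertex u v j)) \<longleftrightarrow>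
    i \<le> k \<and> k \<le> j"
proof -
  have "corner u \<noteq> corner v"
    using assms corner_eq_iff by simp
  moreover have "param u v i \<le> param u v j"
    using assms by (simp add: param_le_iff)
  ultimately have "pos (edge_vertex u v k) \<in> closed_segment (pos (edge_vertex u v i)) (pos (edge_vertex u v j)) \<longleftrightarrow>
      param u v i \<le> param u v k \<and> param u v k \<le> param u v j"
    using assms
    by (auto simp: pos_edge_vertex closed_segment_linepath closed_segment_eq_real_ivl linepath_eq_iff)
  then show ?thesis
    using assms by (simp add: param_le_iff)
qed

lemma pos_edge_vertex_in_disc:
  assumes "u \<in> V" "v \<in> V" "u \<noteq> v" "2 * k \<le> t"
  shows "pos (edge_vertex u v k) \<in> disc u"
proof -
  have "0 < dist (corner u) (corner v)"
    using assms corner_eq_iff by simp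
  then have "0 \<le> param u v k" "param u v k * dist (corner u) (corner v) \<le> \<rho>"
    using placement_near_0[of "\<rho> / dist (corner u) (corner v)" k t] radius_pos assms(4)
    by (simp_all add: param_def pos_le_divide_eq)
  moreover have "corner u - linepath (corner u) (corner v) (param u v k) = param u v k *\<^sub>R (corner u - corner v)"
    by (simp add: linepath_def algebra_simps)
  ultimately show ?thesis
    using assms by (simp add: pos_edge_vertex dist_norm)
qed

lemma pos_edge_vertex_in_chord:
  assumes "u \<in> V" "v \<in> V" "u \<noteq> v" "k \<le> Suc t"
  shows "pos (edge_vertex u v k) \<in> chord u v"
  using pos_edge_vertex_between_iff[of u v 0 "Suc t" k] assms
  by (simp add: edge_vertex_0 edge_vertex_end)

lemma verts_G_near_cases:
  assumes "x \<in> pverts G"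
  obtains (branch) u where "u \<in> V" "x = Branch u"
  | (inner) u v k where "u \<in> V" "v \<in> V" "u \<noteq> v" "0 < k" "2 * k \<le> t" "x = edge_vertex u v k"
  using assms
proof (cases rule: verts_G_cases)
  case (inner u v k)
  show thesis
  proof (cases "2 * k \<le> t")
    case False
    then have "2 * (Suc t - k) \<le> t"
      using even_t by (auto elim!: evenE)
    then show thesis
      using that(2)[of v u "Suc t - k"] inner by (simp add: edge_vertex_swap)
  qed (use that(2) inner in blast)
qed (rule that(1))

lemma inner_vertex_in_adjacent_chord:
  assumes "a \<in> V" "b \<in> V" "c \<in> V" "a \<noteq> b" "a \<noteq> c" "0 < k" "k \<le> Suc t"
    and "pos (edge_vertex a b k) \<in> chord a c"
  shows "b = c"
proof (rule ccontr)
  assume "b \<noteq> c"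
  then have "pos (edge_vertex a b k) = corner a"
    using adjacent_chords_Int[of a b c] assms pos_edge_vertex_in_chord[of a b k] by auto
  then show False
    using pos_edge_vertex_eq_iff[of a b k 0] assms by (simp add: edge_vertex_0)
qed

lemma pos_in_chord_imp_edge_vertex:
  assumes x: "x \<in> pverts G" and uv: "u \<in> V" "v \<in> V" "u \<noteq> v" and in_chord: "pos x \<in> chord u v"
  obtains k where "k \<le> Suc t" "x = edge_vertex u v k"
  using x
proof (cases rule: verts_G_near_cases)
  case (branch a)
  then have "corner a \<in> disc a \<inter> chord u v"
    using in_chord radius_pos by simp
  then have "a = u \<or> a = v"
    using disc_Int_chord[of a u v] branch uv by blast
  then show thesis
    using that[of 0] that[of "Suc t"] branch uv by (auto simp: edge_vertex_0 edge_vertex_end)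
next
  case (inner a b k)
  have "pos x \<in> disc a \<inter> chord u v"
    using in_chord inner pos_edge_vertex_in_disc[of a b k] by simp
  then have "a = u \<or> a = v"
    using disc_Int_chord[of a u v] inner uv by blast
  then show thesis
  proof
    assume "a = u"
    then have "b = v"
      using inner_vertex_in_adjacent_chord[of a b v k] inner uv in_chord by simp
    then show thesis
      using that[of k] inner \<open>a = u\<close> by simp
  next
    assume "a = v"
    then have "b = u"
      using inner_vertex_in_adjacent_chord[of a b u k] inner uv in_chord by (simp add: closed_segment_commute)
    then show thesis
      using that[of "Suc t - k"] inner \<open>a = v\<close> by (simp add: edge_vertex_swap)
  qed
qed

lemma inj_on_pos: "inj_on pos (pverts G)"
proof (rule inj_onI)
  have edge: "x = edge_vertex u v k"
    if x: "x \<in> pverts G" and uv: "u \<in> V" "v \<in> V" "u \<noteq> v" and k: "k \<le> Suc t"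
      and eq: "pos x = pos (edge_vertex u v k)" for x u v k
  proof -
    obtain l where "l \<le> Suc t" "x = edge_vertex u v l"
      using pos_in_chord_imp_edge_vertex[OF x uv] pos_edge_vertex_in_chord[OF uv k] eq by auto
    then show ?thesis
      using pos_edge_vertex_eq_iff[OF uv] k eq by simp
  qed
  fix x y assume x: "x \<in> pverts G" and y: "y \<in> pverts G" and eq: "pos x = pos y"
  from y show "x = y"
  proof (cases rule: verts_G_cases)
    case (inner u v k)
    then show ?thesis using edge[OF x, of u v k] eq by simp
  next
    case (branch v)
    from x show ?thesis
    proof (cases rule: verts_G_cases)
      case (inner a b k)
      then show ?thesis using edge[OF y, of a b k] eq by simp
    next
      case (branch u)
      then show ?thesis using \<open>v \<in> V\<close> \<open>y = Branch v\<close> eq corner_eq_iff by simp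
    qed
  qed
qed

lemma is_drawing_pos: "is_drawing G pos (straight_edge pos)"
proof (rule is_drawing_straight_edge)
  show "pair_loopfree_digraph G"
    using pair_graph_G by (simp add: pair_graph_def pair_digraph_def)
next
  fix x y w
  assume "(x, y) \<in> parcs G" and w: "w \<in> pverts G" and on_edge: "pos w \<in> closed_segment (pos x) (pos y)"
  then obtain u v k where uv: "u \<in> V" "v \<in> V" "u \<noteq> v" "k \<le> t"
    and xy: "x = edge_vertex u v k" "y = edge_vertex u v (Suc k)"
    by (elim parcs_G_cases)
  have "closed_segment (pos x) (pos y) \<subseteq> chord u v"
    using uv pos_edge_vertex_in_chord[of u v] by (simp add: xy subset_closed_segment)
  then obtain l where "l \<le> Suc t" "w = edge_vertex u v l"
    using pos_in_chord_imp_edge_vertex[OF w uv(1-3)] on_edge by blast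
  moreover from this have "k \<le> l \<and> l \<le> Suc k"
    using pos_edge_vertex_between_iff[of u v k "Suc k" l] uv on_edge by (simp add: xy)
  ultimately show "w \<in> {x, y}"
    by (auto simp: xy le_Suc_eq)
qed (rule inj_on_pos)

abbreviation track :: "'a sd_vertex list \<Rightarrow> (real \<times> real) set" where
  "track p \<equiv> path_image (polyline (map pos p))"

definition initial_part :: "'a \<Rightarrow> 'a \<Rightarrow> nat \<Rightarrow> (real \<times> real) set" where
  "initial_part u v k = closed_segment (corner u) (pos (edge_vertex u v k))"

lemma initial_part_end: "u \<noteq> v \<Longrightarrow> initial_part u v (Suc t) = chord u v"
  by (simp add: initial_part_def edge_vertex_end)

lemma chord_part_initial_part:
  assumes "u \<in> V" "v \<in> V" "u \<noteq> v" "k \<le> Suc t"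
  shows "chord_part u v (initial_part u v k)"
  using pos_edge_vertex_in_chord[OF assms]
  by (simp add: chord_part_def initial_part_def subset_closed_segment)

lemma leg_initial_part:
  assumes "u \<in> V" "v \<in> V" "u \<noteq> v" "2 * k \<le> Suc t"
  shows "leg u (initial_part u v k)"
proof -
  have "2 * k \<le> t"
    using assms(4) even_t by (auto elim!: evenE)
  then have "pos (edge_vertex u v k) \<in> disc u"
    using assms by (intro pos_edge_vertex_in_disc)
  then have "initial_part u v k \<subseteq> disc u"
    unfolding initial_part_def using radius_pos by (intro closed_segment_subset) auto
  then show ?thesis
    by (simp add: leg_def initial_part_def)
qed

lemma
  assumes "u \<in> V" "v \<in> V" "u \<noteq> v" "i < j" "j \<le> Suc t"
  shows arc_run: "arc (polyline (map pos (run u v i j)))"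
    and track_run: "track (run u v i j) = closed_segment (pos (edge_vertex u v i)) (pos (edge_vertex u v j))"
proof -
  let ?f = "\<lambda>k. pos (edge_vertex u v k)"
  have "map pos (run u v i j) = map ?f [i..<Suc j]"
    by (simp add: run_def)
  moreover have "?f k \<noteq> ?f (Suc k)" "?f (Suc k) \<in> closed_segment (?f k) (?f j)" if "k < j" for k
    using that assms by (simp_all add: pos_edge_vertex_eq_iff pos_edge_vertex_between_iff)
  ultimately show "arc (polyline (map pos (run u v i j)))" "track (run u v i j) = closed_segment (?f i) (?f j)"
    using polyline_along_segment[of i j ?f] \<open>i < j\<close> by simp_all
qed

lemma track_initial_run:
  assumes "u \<in> V" "v \<in> V" "u \<noteq> v" "0 < j" "j \<le> Suc t"
  shows "track (run u v 0 j) = initial_part u v j"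
  using assms by (simp add: track_run initial_part_def edge_vertex_0)

lemma track_final_run:
  assumes "u \<in> V" "v \<in> V" "u \<noteq> v" "i \<le> t"
  shows "track (run u v i (Suc t)) = initial_part v u (Suc t - i)"
  using assms
  by (simp add: track_run initial_part_def edge_vertex_end edge_vertex_swap closed_segment_commute)

lemma
  assumes V: "u \<in> V" "v \<in> V" "u \<noteq> v" "i \<le> t" and rest: "distinct_adj (v # w # us)" "0 < j"
  defines "q \<equiv> route 0 j (v # w # us)"
  shows track_route_Cons: "track (route i j (u # v # w # us)) = initial_part v u (Suc t - i) \<union> track q"
    and arc_route_Cons: "\<lbrakk>arc (polyline (map pos q)); initial_part v u (Suc t - i) \<inter> track q \<subseteq> {corner v}\<rbrakk>
      \<Longrightarrow> arc (polyline (map pos (route i j (u # v # w # us))))"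
proof -
  let ?p = "run u v i (Suc t)"
  have route: "map pos (route i j (u # v # w # us)) = map pos ?p \<oplus> map pos q"
    by (simp add: q_def vwalk_join_def map_tl)
  have hd: "hd (map pos q) = corner v"
    unfolding q_def using rest hd_route[of 0 us j v w] route_neq_Nil[of 0 us j v w]
    by (simp add: hd_map edge_vertex_0)
  have joinable: "2 \<le> length (map pos ?p)" "2 \<le> length (map pos q)" "last (map pos ?p) = hd (map pos q)"
    unfolding hd using V rest length_route[of "v # w # us" 0 j]
    by (simp_all add: q_def last_map edge_vertex_end)
  show "track (route i j (u # v # w # us)) = initial_part v u (Suc t - i) \<union> track q"
    unfolding route path_image_polyline_join[OF joinable] track_final_run[OF V] ..
  assume "arc (polyline (map pos q))" "initial_part v u (Suc t - i) \<inter> track q \<subseteq> {corner v}"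
  then show "arc (polyline (map pos (route i j (u # v # w # us))))"
    using arc_polyline_join[OF joinable] arc_run[of u v i "Suc t"] track_final_run[OF V] V
    unfolding route hd by simp
qed

lemma
  assumes V: "{u, v, w} \<subseteq> V" "distinct [u, v, w]" and bounds: "i \<le> t" "0 < j" "j \<le> Suc t"
  shows arc_two_edge_route: "arc (polyline (map pos (route i j [u, v, w])))"
    and track_two_edge_route: "track (route i j [u, v, w]) = initial_part v u (Suc t - i) \<union> initial_part v w j"
proof -
  have "chord_part v u (initial_part v u (Suc t - i))" "chord_part v w (initial_part v w j)"
    using V bounds by (auto intro: chord_part_initial_part)
  then have "initial_part v u (Suc t - i) \<inter> initial_part v w j \<subseteq> {corner v}"
    using adjacent_chords_Int[of v u w] V unfolding chord_part_def by auto
  moreover have "arc (polyline (map pos (run v w 0 j)))" "track (run v w 0 j) = initial_part v w j"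
    using V bounds by (simp_all add: arc_run track_initial_run)
  ultimately show "arc (polyline (map pos (route i j [u, v, w])))"
    "track (route i j [u, v, w]) = initial_part v u (Suc t - i) \<union> initial_part v w j"
    using arc_route_Cons[of u v i w "[]" j] track_route_Cons[of u v i w "[]" j] V bounds by simp_all
qed

lemma
  assumes V: "{u, v, w, z} \<subseteq> V" "distinct [u, v, w]" "distinct [v, w, z]"
    and bounds: "i \<le> t" "0 < j" "Suc t \<le> 2 * i" "2 * j \<le> Suc t"
  shows arc_three_edge_route: "arc (polyline (map pos (route i j [u, v, w, z])))"
    and track_three_edge_route:
      "track (route i j [u, v, w, z]) = chord v w \<union> initial_part v u (Suc t - i) \<union> initial_part w z j"
proof -
  let ?L = "initial_part v u (Suc t - i)" and ?M = "initial_part w z j"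
  have "initial_part w v (Suc t) = chord v w"
    using initial_part_end[of w v] V by (auto simp: closed_segment_commute)
  then have rest: "arc (polyline (map pos (route 0 j [v, w, z])))" "track (route 0 j [v, w, z]) = chord v w \<union> ?M"
    using arc_two_edge_route[of v w z 0 j] track_two_edge_route[of v w z 0 j] V bounds
    by (simp_all del: route.simps)
  have "?L \<inter> chord v w \<subseteq> {corner v}"
    using adjacent_chords_Int[of v u w] chord_part_initial_part[of v u "Suc t - i"] V
    unfolding chord_part_def by auto
  moreover have "leg v ?L" "leg w ?M"
    using V bounds by (auto intro!: leg_initial_part)
  then have "?L \<inter> ?M = {}"
    using leg_Int_leg[of v w] V by auto
  ultimately have "?L \<inter> track (route 0 j [v, w, z]) \<subseteq> {corner v}"
    unfolding rest(2) by blast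
  then show "arc (polyline (map pos (route i j [u, v, w, z])))"
    "track (route i j [u, v, w, z]) = chord v w \<union> ?L \<union> ?M"
    using arc_route_Cons[of u v i w "[z]" j] track_route_Cons[of u v i w "[z]" j] rest V bounds
    by (simp_all add: Un_ac del: route.simps)
qed

lemma shortest_path_track:
  assumes "shortest_path G p" "2 \<le> length p"
  shows "arc (polyline (map pos p)) \<and> bent_shape (track p)"
  using assms
proof (cases rule: shortest_path_cases)
  case (one_edge u v i j)
  then show ?thesis
    by (simp add: arc_run track_run bent_shape_def)
next
  case (two_edges u v w i j)
  have "chord_part v u (initial_part v u (Suc t - i))" "chord_part v w (initial_part v w j)"
    using two_edges by (auto intro: chord_part_initial_part)
  moreover have "{v, u, w} \<subseteq> V" "distinct [v, u, w]"
    using two_edges(1,2) by auto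
  ultimately have "fork (initial_part v u (Suc t - i) \<union> initial_part v w j)"
    unfolding fork_def by blast
  then show ?thesis
    using arc_two_edge_route[OF two_edges(1-5)] track_two_edge_route[OF two_edges(1-5)] two_edges(6)
    by (simp add: bent_shape_def)
next
  case (three_edges u v w z i j)
  have "leg v (initial_part v u (Suc t - i))" "leg w (initial_part w z j)"
    using three_edges by (auto intro!: leg_initial_part)
  moreover have "{v, w} \<subseteq> V"
    using three_edges(1) by auto
  ultimately have "chord_with_legs (chord v w \<union> initial_part v u (Suc t - i) \<union> initial_part w z j)"
    unfolding chord_with_legs_def by blast
  then show ?thesis
    using arc_three_edge_route[OF three_edges(1-7)] track_three_edge_route[OF three_edges(1-7)] three_edges(8)
    by (simp add: bent_shape_def)
qed

lemma shortest_paths_cross_at_most_4: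
  assumes p: "shortest_path G p" "2 \<le> length p" and q: "shortest_path G q" "2 \<le> length q"
  shows "cross_at_most 4 (path_curve pos (straight_edge pos) p) (path_curve pos (straight_edge pos) q)"
  unfolding path_curve_straight_edge[OF p(2)] path_curve_straight_edge[OF q(2)]
  using shortest_path_track[OF p] shortest_path_track[OF q]
  by (intro cross_at_most_if_union_of_connected bent_shapes_Int) simp_all

end

lemma ex_subdivision_drawing:
  fixes K :: "'a::linorder pair_pre_digraph"
  assumes "even t" "complete_digraph n (with_proj K)"
  obtains corner \<rho> where "subdivision_drawing n t K corner \<rho>"
proof -
  have "finite (pverts K)"
    using assms(2) by (simp add: complete_digraph_pair_def)
  then obtain r :: "'a \<Rightarrow> nat" where r: "inj_on r (pverts K)"
    using finite_imp_inj_to_nat_seg by blast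
  define corner where "corner u = (real (r u), (real (r u))\<^sup>2)" for u
  have "\<not> collinear {corner u, corner v, corner w}"
    if "{u, v, w} \<subseteq> pverts K" "distinct [u, v, w]" for u v w
    using that r unfolding corner_def by (intro parabola_noncollinear) (auto dest: inj_onD)
  then have "general_position corner (pverts K)"
    using r unfolding general_position_def by (auto simp: inj_on_def corner_def)
  then obtain \<rho> where "corner_discs (pverts K) corner \<rho>"
    using ex_corner_discs[OF \<open>finite (pverts K)\<close>] by blast
  then have "subdivision_drawing n t K corner \<rho>"
    using assms by (simp add: subdivision_drawing_def subdivision_drawing_axioms_def complete_subdivision_def)
  then show thesis ..
qed

theorem theorem2:
  fixes n t :: nat and K :: "'a::linorder pair_pre_digraph"
  assumes "n \<ge> 1" and "even t" and "complete_digraph n (with_proj K)"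
  shows "\<exists>pos crv. is_drawing (subdivide_all t K) pos crv \<and>
           (\<forall>P\<^sub>1 P\<^sub>2. shortest_path (subdivide_all t K) P\<^sub>1 \<and> shortest_path (subdivide_all t K) P\<^sub>2 \<and>
              vwalk_length P\<^sub>1 \<ge> 1 \<and> vwalk_length P\<^sub>2 \<ge> 1 \<longrightarrow>
              cross_at_most 4 (path_curve pos crv P\<^sub>1) (path_curve pos crv P\<^sub>2))"
proof -
  obtain corner \<rho> where "subdivision_drawing n t K corner \<rho>"
    using assms(2,3) by (rule ex_subdivision_drawing)
  then interpret subdivision_drawing n t K corner \<rho> .
  show ?thesis
  proof (intro exI conjI allI impI)
    show "is_drawing G pos (straight_edge pos)"
      by (rule is_drawing_pos)
    fix P\<^sub>1 P\<^sub>2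
    assume "shortest_path G P\<^sub>1 \<and> shortest_path G P\<^sub>2 \<and> vwalk_length P\<^sub>1 \<ge> 1 \<and> vwalk_length P\<^sub>2 \<ge> 1"
    then show "cross_at_most 4 (path_curve pos (straight_edge pos) P\<^sub>1) (path_curve pos (straight_edge pos) P\<^sub>2)"
      by (intro shortest_paths_cross_at_most_4) auto
  qed
qed

end
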